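(* Let $n$ be a positive integer and $\varepsilon\in\{-1,1\}$. The families of solutions of the equation $u_t+xu_y=u_{xx}$ that are invariant with respect to its generalized symmetries $\bigl((\mathfrak P^2+\varepsilon\mathfrak P^0)^nu\bigr)\partial_u$, $\bigl((\mathfrak P^1)^nu\bigr)\partial_u$ or $\bigl((\mathfrak P^0)^nu\bigr)\partial_u$ (i.e., the families of solutions satisfying in addition $(\mathfrak P^2+\varepsilon\mathfrak P^0)^nu=0$, $(\mathfrak P^1)^nu=0$ or $(\mathfrak P^0)^nu=0$) respectively take the form $$u=\sum_{k=0}^{n-1}(\mathfrak P^1)^k\Bigl(|t|^{-\frac12}e^{-\frac{x^2}{4t}}\theta^k(z_1,z_2)\Bigr)\quad\text{with}\quad z_1=\tfrac13t^3+2\varepsilon t-t^{-1},\quad z_2=2y-(t+\varepsilon t^{-1})x,$$ $$u=\sum_{k=0}^{n-1}(\mathfrak P^2)^k\theta^k(z_1,z_2)\quad\text{with}\quad z_1=\tfrac13t^3,\quad z_2=y-tx,$$ $$u=\sum_{k=0}^{n-1}(\mathfrak P^3)^k\theta^k(z_1,z_2)\quad\text{with}\quad z_1=t,\quad z_2=x,$$ where $\theta^k=\theta^k(z_1,z_2)$, $k=0,\dots,n-1$, are arbitrary solutions of the (1+1)-dimensional linear heat equation $\theta^k_{z_1}=\theta^k_{z_2z_2}$.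
   Context: Here $u=u(t,x,y)$ is real-valued, and $$\mathfrak P^3:=3t^2\mathrm D_x+t^3\mathrm D_y-3(y-tx),\quad \mathfrak P^2:=2t\mathrm D_x+t^2\mathrm D_y+x,\quad \mathfrak P^1:=\mathrm D_x+t\mathrm D_y,\quad \mathfrak P^0:=\mathrm D_y$$ are first-order linear differential operators, where $\mathrm D_x$ and $\mathrm D_y$ are the operators of total derivatives with respect to $x$ and $y$ (acting on functions of $(t,x,y)$ simply as $\partial_x$ and $\partial_y$). These operators preserve the solution set of the equation $u_t+xu_y=u_{xx}$. A solution is invariant with respect to a generalized symmetry $\eta\,\partial_u$ if the characteristic $\eta$ vanishes on it. Solutions are smooth and considered locally, where the expressions involved are defined (in particular, $t\ne0$ in the first family). *)

theory Defs
  imports "HOL-Analysis.Analysis"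
begin

definition dir_deriv :: "'a \<Rightarrow> ('a::real_normed_vector \<Rightarrow> real) \<Rightarrow> 'a \<Rightarrow> real" where
  "dir_deriv v f = (\<lambda>p. frechet_derivative f (at p) v)"

primrec Ck_on :: "nat \<Rightarrow> 'a::real_normed_vector set \<Rightarrow> ('a \<Rightarrow> real) \<Rightarrow> bool" where
  "Ck_on 0 S f \<longleftrightarrow> continuous_on S f"
| "Ck_on (Suc k) S f \<longleftrightarrow>
     (\<forall>p\<in>S. f differentiable (at p)) \<and> (\<forall>v. Ck_on k S (dir_deriv v f))"

(* Intended for open S; values of f outside S are then irrelevant. *)
definition smooth_on :: "'a::real_normed_vector set \<Rightarrow> ('a \<Rightarrow> real) \<Rightarrow> bool" where
  "smooth_on S f \<longleftrightarrow> (\<forall>k. Ck_on k S f)"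

(* Points of the space of independent variables are triples (t, x, y). *)
type_synonym pt = "real \<times> real \<times> real"

abbreviation Dt :: "(pt \<Rightarrow> real) \<Rightarrow> pt \<Rightarrow> real" where "Dt \<equiv> dir_deriv (1, 0, 0)"
abbreviation Dx :: "(pt \<Rightarrow> real) \<Rightarrow> pt \<Rightarrow> real" where "Dx \<equiv> dir_deriv (0, 1, 0)"
abbreviation Dy :: "(pt \<Rightarrow> real) \<Rightarrow> pt \<Rightarrow> real" where "Dy \<equiv> dir_deriv (0, 0, 1)"

definition P3 :: "(pt \<Rightarrow> real) \<Rightarrow> pt \<Rightarrow> real" where
  "P3 u = (\<lambda>(t, x, y). 3 * t^2 * Dx u (t, x, y) + t^3 * Dy u (t, x, y)
                        - 3 * (y - t * x) * u (t, x, y))"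

definition P2 :: "(pt \<Rightarrow> real) \<Rightarrow> pt \<Rightarrow> real" where
  "P2 u = (\<lambda>(t, x, y). 2 * t * Dx u (t, x, y) + t^2 * Dy u (t, x, y) + x * u (t, x, y))"

definition P1 :: "(pt \<Rightarrow> real) \<Rightarrow> pt \<Rightarrow> real" where
  "P1 u = (\<lambda>(t, x, y). Dx u (t, x, y) + t * Dy u (t, x, y))"

definition P0 :: "(pt \<Rightarrow> real) \<Rightarrow> pt \<Rightarrow> real" where
  "P0 u = Dy u"

definition solution :: "pt set \<Rightarrow> (pt \<Rightarrow> real) \<Rightarrow> bool" where
  "solution \<Omega> u \<longleftrightarrow> open \<Omega> \<and> smooth_on \<Omega> u \<and>
     (\<forall>(t, x, y)\<in>\<Omega>. Dt u (t, x, y) + x * Dy u (t, x, y) = Dx (Dx u) (t, x, y))"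

(* Q is the linear operator of the symmetry (Q u) d/du, whose characteristic is Q u. *)
definition invariant_solution ::
    "pt set \<Rightarrow> ((pt \<Rightarrow> real) \<Rightarrow> pt \<Rightarrow> real) \<Rightarrow> (pt \<Rightarrow> real) \<Rightarrow> bool" where
  "invariant_solution \<Omega> Q u \<longleftrightarrow> solution \<Omega> u \<and> (\<forall>p\<in>\<Omega>. Q u p = 0)"

definition heat_solution :: "(real \<times> real) set \<Rightarrow> (real \<times> real \<Rightarrow> real) \<Rightarrow> bool" where
  "heat_solution V \<theta> \<longleftrightarrow> open V \<and> smooth_on V \<theta> \<and>
     (\<forall>q\<in>V. dir_deriv (1, 0) \<theta> q = dir_deriv (0, 1) (dir_deriv (0, 1) \<theta>) q)"

(* In a neighbourhood U of each point of \<Omega>, u is the sum over k < n of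
   Q^k (w * \<theta>^k(z1, z2)), where z = (z1, z2) and the \<theta>^k are solutions of the heat
   equation defined (at least) on the values taken by z on U. *)
definition locally_represented ::
    "pt set \<Rightarrow> nat \<Rightarrow> ((pt \<Rightarrow> real) \<Rightarrow> pt \<Rightarrow> real) \<Rightarrow> (pt \<Rightarrow> real) \<Rightarrow> (pt \<Rightarrow> real \<times> real)
      \<Rightarrow> (pt \<Rightarrow> real) \<Rightarrow> bool" where
  "locally_represented \<Omega> n Q w z u \<longleftrightarrow>
     (\<forall>p\<in>\<Omega>. \<exists>U V \<theta>. open U \<and> p \<in> U \<and> U \<subseteq> \<Omega> \<and> z ` U \<subseteq> V \<and>
        (\<forall>k<n. heat_solution V (\<theta> k)) \<and>
        (\<forall>q\<in>U. u q = (\<Sum>k<n. (Q ^^ k) (\<lambda>r. w r * \<theta> k (z r)) q)))"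

end

(*
Let A be the operator of the symmetry, B the operator of the representation and L the operator of
the equation. Both A and B commute with L, and [A, B] is a nonzero constant c. Hence A^k B^k acts
on ker A as multiplication by c^k k!, and ker A^n is the sum of the spaces B^k (ker A), k < n.

A function v in the common kernel of A and L is w g, where g is constant along the (x, y)-part of A.
For a constant vector e transversal to this direction, the iterated derivatives G_j of g along e
satisfy dG_j = G_{j+2} dz1 + G_{j+1} dz2, so locally they are functions of z = (z1, z2), and g
becomes a solution of the heat equation. Since dz1/dt is a square that may vanish (at t = 0 for P1,
at t = 1 and t = -1 for P2 - P0), z1 is only a homeomorphism in t; that g is nevertheless smooth as
a function of z1 comes from the factor dz1/dt in the time derivatives of all the G_j.
*)

theory Submission
  imports Defs
begin

subsection \<open>Smooth functions and directional derivatives\<close>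

text \<open>All operators involved have the form
  \<open>a(t) Dx + b(t) Dy + \<alpha>(t) x + \<beta> y\<close> with \<open>b' = a\<close>,
  \<open>a' = 2 \<alpha>\<close>, \<open>\<alpha>' = - \<beta>\<close>, so each is determined by the
  cubic b: t^3, t^2, t, 1 for \<open>P3\<close>, \<open>P2\<close>, \<open>P1\<close>,
  \<open>P0\<close>. The three pairs (A, B) differ only in these data and in the constant c, which
  is -1, 1, -3. The sum of the B^k v_k exists on all of \<Omega>. Only the passage from v_k to
  \<theta>^k is local: a level set of z in \<Omega> may be disconnected, and then v_k / w need not
  be a single function of z. The obstacle is a zero of dz1/dt. The function t is smooth but is not a
  smooth function of t^3/3, so smoothness of v alone cannot give smoothness of \<theta>. The
  equation yields one z1-derivative of g, namely G_2; the next one is needed for G_2 itself, and so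
  on. Hence the whole sequence G_j is carried along and smoothness is proved for all its members at
  once.\<close>

lemma dir_deriv_eq:
  "(f has_derivative f') (at p) \<Longrightarrow> dir_deriv v f p = f' v"
  by (simp add: dir_deriv_def frechet_derivative_at[symmetric])

lemma has_derivative_dir_deriv:
  assumes "f differentiable (at p)"
  shows "(f has_derivative (\<lambda>v. dir_deriv v f p)) (at p)"
  using assms by (simp add: dir_deriv_def frechet_derivative_works[symmetric])

text \<open>\<open>frechet_derivative\<close> is a Hilbert choice. Functions equal near p have the
  same derivatives there, so the choice agrees even at points where neither function is
  differentiable.\<close>

lemma dir_deriv_cong:
  assumes "open S" "p \<in> S" "\<And>q. q \<in> S \<Longrightarrow> f q = g q"
  shows "dir_deriv v f p = dir_deriv v g p"
proof -
  have "(f has_derivative f') (at p) \<longleftrightarrow> (g has_derivative f') (at p)" for f'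
    using assms by (metis has_derivative_transform_within_open)
  then show ?thesis by (simp add: dir_deriv_def frechet_derivative_def)
qed

lemma Ck_on_cong:
  assumes "open S" "\<And>q. q \<in> S \<Longrightarrow> f q = g q"
  shows "Ck_on k S f \<longleftrightarrow> Ck_on k S g"
  using assms(2)
proof (induction k arbitrary: f g)
  case 0
  then show ?case by (simp cong: continuous_on_cong)
next
  case (Suc k)
  have "f differentiable (at p) \<longleftrightarrow> g differentiable (at p)" if "p \<in> S" for p
    using assms(1) that Suc.prems unfolding differentiable_def
    by (metis has_derivative_transform_within_open)
  moreover have "Ck_on k S (dir_deriv v f) \<longleftrightarrow> Ck_on k S (dir_deriv v g)" for v
    by (rule Suc.IH) (rule dir_deriv_cong[OF assms(1) _ Suc.prems])
  ultimately show ?case by simp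
qed

lemma Ck_on_SucD: "Ck_on (Suc k) S f \<Longrightarrow> Ck_on k S f"
proof (induction k arbitrary: f)
  case 0
  then have "f differentiable (at p within S)" if "p \<in> S" for p
    using that differentiable_at_withinI by auto
  then show ?case
    by (simp add: differentiable_imp_continuous_on differentiable_on_def)
next
  case (Suc k)
  then show ?case by (metis Ck_on.simps(2))
qed

lemma Ck_on_subset: "Ck_on k S f \<Longrightarrow> T \<subseteq> S \<Longrightarrow> Ck_on k T f"
  by (induction k arbitrary: f) (auto intro: continuous_on_subset)

text \<open>Lets an explicit derivative F stand for \<open>dir_deriv\<close>. The two agree on S
  only, which is why S has to be open.\<close>

lemma Ck_on_SucI:
  assumes "open S" "\<And>p. p \<in> S \<Longrightarrow> (f has_derivative F p) (at p)"
    "\<And>v. Ck_on k S (\<lambda>p. F p v)"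
  shows "Ck_on (Suc k) S f"
proof -
  have "Ck_on k S (dir_deriv v f)" for v
    using Ck_on_cong[OF assms(1), of "dir_deriv v f" "\<lambda>p. F p v"] dir_deriv_eq assms(2,3)
    by metis
  then show ?thesis using assms(2) by (auto simp: differentiable_def)
qed

lemma Ck_on_has_derivative:
  "Ck_on (Suc k) S f \<Longrightarrow> p \<in> S \<Longrightarrow> (f has_derivative (\<lambda>v. dir_deriv v f p)) (at p)"
  by (simp add: has_derivative_dir_deriv)

lemma Ck_on_const: "Ck_on k S (\<lambda>_. c)"
proof (induction k arbitrary: c)
  case (Suc k)
  have "dir_deriv v (\<lambda>_. c) = (\<lambda>_. 0)" for v :: 'a
    by (rule ext) (rule dir_deriv_eq[OF has_derivative_const])
  then show ?case using Suc by simp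
qed simp

lemma Ck_on_bounded_linear:
  assumes "bounded_linear f"
  shows "Ck_on k S f"
proof (cases k)
  case 0
  then show ?thesis using assms by (simp add: linear_continuous_on)
next
  case (Suc j)
  have "dir_deriv v f = (\<lambda>_. f v)" for v
    by (rule ext) (rule dir_deriv_eq[OF bounded_linear_imp_has_derivative[OF assms]])
  then show ?thesis
    using Suc bounded_linear_imp_differentiable[OF assms] by (simp add: Ck_on_const)
qed

lemma Ck_on_add:
  assumes "open S"
  shows "Ck_on k S f \<Longrightarrow> Ck_on k S g \<Longrightarrow> Ck_on k S (\<lambda>p. f p + g p)"
proof (induction k arbitrary: f g)
  case (Suc k)
  have "Ck_on k S (\<lambda>p. dir_deriv v f p + dir_deriv v g p)" for v
    using Suc by auto
  moreover have "((\<lambda>p. f p + g p) has_derivative (\<lambda>v. dir_deriv v f p + dir_deriv v g p)) (at p)"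
    if "p \<in> S" for p
    using that Suc.prems by (intro has_derivative_add Ck_on_has_derivative)
  ultimately show ?case by (intro Ck_on_SucI[OF assms])
qed (auto intro: continuous_intros)

lemma Ck_on_mult:
  assumes "open S"
  shows "Ck_on k S f \<Longrightarrow> Ck_on k S g \<Longrightarrow> Ck_on k S (\<lambda>p. f p * g p)"
proof (induction k arbitrary: f g)
  case (Suc k)
  have "Ck_on k S f" "Ck_on k S g" using Suc.prems Ck_on_SucD by blast+
  then have "Ck_on k S (\<lambda>p. f p * dir_deriv v g p + dir_deriv v f p * g p)" for v
    using Suc by (intro Ck_on_add[OF assms] Suc.IH) auto
  moreover have "((\<lambda>p. f p * g p) has_derivative
      (\<lambda>v. f p * dir_deriv v g p + dir_deriv v f p * g p)) (at p)" if "p \<in> S" for p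
    using that Suc.prems by (intro has_derivative_mult Ck_on_has_derivative)
  ultimately show ?case by (intro Ck_on_SucI[OF assms])
qed (auto intro: continuous_intros)

lemma dir_deriv_pair:
  fixes \<theta> :: "real \<times> real \<Rightarrow> real"
  assumes "\<theta> differentiable (at q)"
  shows "dir_deriv (r, s) \<theta> q = r * dir_deriv (1, 0) \<theta> q + s * dir_deriv (0, 1) \<theta> q"
proof -
  interpret bounded_linear "\<lambda>v. dir_deriv v \<theta> q"
    by (rule has_derivative_bounded_linear[OF has_derivative_dir_deriv[OF assms]])
  have "dir_deriv (r, s) \<theta> q = dir_deriv (r *\<^sub>R (1, 0) + s *\<^sub>R (0, 1)) \<theta> q" by simp
  also have "\<dots> = r * dir_deriv (1, 0) \<theta> q + s * dir_deriv (0, 1) \<theta> q"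
    by (simp only: add scaleR real_scaleR_def)
  finally show ?thesis .
qed

text \<open>Induction on the order for all \<theta> at once: by the chain rule the derivatives
  involve the partial derivatives of \<theta>, one order lower, composed with the same
  \<open>z1\<close> and \<open>z2\<close>.\<close>

lemma Ck_on_compose_pair:
  fixes \<theta> :: "real \<times> real \<Rightarrow> real"
  assumes "open S" "open V" and "\<And>p. p \<in> S \<Longrightarrow> (z1 p, z2 p) \<in> V"
  shows "Ck_on k V \<theta> \<Longrightarrow> Ck_on k S z1 \<Longrightarrow> Ck_on k S z2 \<Longrightarrow> Ck_on k S (\<lambda>p. \<theta> (z1 p, z2 p))"
proof (induction k arbitrary: \<theta>)
  case 0
  have "continuous_on S (\<lambda>p. (z1 p, z2 p))" using 0 by (auto intro: continuous_intros)
  then show ?case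
    using continuous_on_compose2[of V \<theta> S "\<lambda>p. (z1 p, z2 p)"] 0 assms(3) by auto
next
  case (Suc k)
  have low: "Ck_on k S z1" "Ck_on k S z2" using Suc.prems Ck_on_SucD by blast+
  show ?case
  proof (rule Ck_on_SucI[OF assms(1), where F = "\<lambda>p v. dir_deriv v z1 p * dir_deriv (1, 0) \<theta> (z1 p, z2 p)
      + dir_deriv v z2 p * dir_deriv (0, 1) \<theta> (z1 p, z2 p)"])
    fix p assume p: "p \<in> S"
    have "((\<lambda>p. (z1 p, z2 p)) has_derivative (\<lambda>v. (dir_deriv v z1 p, dir_deriv v z2 p))) (at p)"
      using p Suc.prems by (intro has_derivative_Pair Ck_on_has_derivative)
    from has_derivative_compose[OF this Ck_on_has_derivative[OF Suc.prems(1) assms(3)[OF p]]]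
    show "((\<lambda>p. \<theta> (z1 p, z2 p)) has_derivative
      (\<lambda>v. dir_deriv v z1 p * dir_deriv (1, 0) \<theta> (z1 p, z2 p)
        + dir_deriv v z2 p * dir_deriv (0, 1) \<theta> (z1 p, z2 p))) (at p)"
      by (rule has_derivative_eq_rhs) (rule ext, rule dir_deriv_pair, use Suc.prems(1) assms(3)[OF p] in simp)
  next
    fix v
    have "Ck_on k S (\<lambda>p. dir_deriv w \<theta> (z1 p, z2 p))" for w
      \<comment> \<open>The quantifier over directions in \<open>Ck_on\<close> has to stay unsplit,
        so that it matches the pair w.\<close>
      by (rule Suc.IH[OF _ low]) (use Suc.prems(1) in \<open>simp del: split_paired_All\<close>)
    moreover have "Ck_on k S (dir_deriv v z1)" "Ck_on k S (dir_deriv v z2)"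
      using Suc.prems by auto
    ultimately show "Ck_on k S (\<lambda>p. dir_deriv v z1 p * dir_deriv (1, 0) \<theta> (z1 p, z2 p)
      + dir_deriv v z2 p * dir_deriv (0, 1) \<theta> (z1 p, z2 p))"
      by (intro Ck_on_add Ck_on_mult assms(1))
  qed
qed

lemma smooth_onD: "smooth_on S f \<Longrightarrow> Ck_on k S f"
  by (simp add: smooth_on_def)

lemma smooth_on_has_derivative:
  "smooth_on S f \<Longrightarrow> p \<in> S \<Longrightarrow> (f has_derivative (\<lambda>v. dir_deriv v f p)) (at p)"
  using Ck_on_has_derivative smooth_onD by blast

lemma smooth_on_dir_deriv: "smooth_on S f \<Longrightarrow> smooth_on S (dir_deriv v f)"
  unfolding smooth_on_def by (metis Ck_on.simps(2))

lemma smooth_on_cong: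
  "open S \<Longrightarrow> (\<And>q. q \<in> S \<Longrightarrow> f q = g q) \<Longrightarrow> smooth_on S f \<longleftrightarrow> smooth_on S g"
  unfolding smooth_on_def using Ck_on_cong by blast

lemma smooth_on_subset: "smooth_on S f \<Longrightarrow> T \<subseteq> S \<Longrightarrow> smooth_on T f"
  unfolding smooth_on_def using Ck_on_subset by blast

lemma smooth_on_const: "smooth_on S (\<lambda>_. c)"
  by (simp add: smooth_on_def Ck_on_const)

lemma smooth_on_bounded_linear: "bounded_linear f \<Longrightarrow> smooth_on S f"
  by (simp add: smooth_on_def Ck_on_bounded_linear)

lemma smooth_on_add:
  "open S \<Longrightarrow> smooth_on S f \<Longrightarrow> smooth_on S g \<Longrightarrow> smooth_on S (\<lambda>p. f p + g p)"
  by (simp add: smooth_on_def Ck_on_add)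

lemma smooth_on_mult:
  "open S \<Longrightarrow> smooth_on S f \<Longrightarrow> smooth_on S g \<Longrightarrow> smooth_on S (\<lambda>p. f p * g p)"
  by (simp add: smooth_on_def Ck_on_mult)

lemma smooth_on_cmult: "open S \<Longrightarrow> smooth_on S f \<Longrightarrow> smooth_on S (\<lambda>p. c * f p)"
  by (intro smooth_on_mult smooth_on_const)

lemma smooth_on_minus: "open S \<Longrightarrow> smooth_on S f \<Longrightarrow> smooth_on S (\<lambda>p. - f p)"
  using smooth_on_cmult[of S f "-1"] by simp

lemma smooth_on_sum:
  "open S \<Longrightarrow> (\<And>k. k \<in> K \<Longrightarrow> smooth_on S (f k)) \<Longrightarrow> smooth_on S (\<lambda>p. \<Sum>k\<in>K. f k p)"
  by (induction K rule: infinite_finite_induct) (auto intro: smooth_on_const smooth_on_add)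

lemma smooth_on_local:
  assumes "\<And>p. p \<in> S \<Longrightarrow> \<exists>U. open U \<and> p \<in> U \<and> smooth_on U f"
  shows "smooth_on S f"
proof -
  have "Ck_on k S g" if "\<And>p. p \<in> S \<Longrightarrow> \<exists>U. open U \<and> p \<in> U \<and> Ck_on k U g" for k g
    using that
  proof (induction k arbitrary: g)
    case 0
    have "isCont g p" if "p \<in> S" for p
      using 0[OF that] continuous_on_eq_continuous_at by auto
    then show ?case by (simp add: continuous_at_imp_continuous_on)
  next
    case (Suc k)
    then show ?case unfolding Ck_on.simps by meson
  qed
  then show ?thesis using assms unfolding smooth_on_def by meson
qed

lemma smooth_on_fst_snd: "smooth_on S (\<lambda>p::pt. fst (snd p))"
  by (intro smooth_on_bounded_linear bounded_linear_fst_comp bounded_linear_snd)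

lemma smooth_on_snd_snd: "smooth_on S (\<lambda>p::pt. snd (snd p))"
  by (intro smooth_on_bounded_linear bounded_linear_snd_comp bounded_linear_snd)

lemma has_field_derivative_along:
  assumes "(f has_derivative f') (at (p + s *\<^sub>R v))"
  shows "((\<lambda>s. f (p + s *\<^sub>R v)) has_real_derivative f' v) (at s)"
proof -
  have "((\<lambda>s. p + s *\<^sub>R v) has_derivative (\<lambda>h. h *\<^sub>R v)) (at s)"
    by (auto intro!: derivative_eq_intros)
  from has_derivative_compose[OF this assms]
  have "((\<lambda>s. f (p + s *\<^sub>R v)) has_derivative (\<lambda>h. f' (h *\<^sub>R v))) (at s)" .
  then show ?thesis
    unfolding has_field_derivative_def
    using has_derivative_bounded_linear[OF assms]
    by (simp add: linear_simps mult_commute_abs)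
qed

section \<open>Symmetry of second derivatives\<close>

lemma second_difference_mean_value:
  assumes "Ck_on 2 S f" "h > 0"
    and S: "\<And>a b. 0 \<le> a \<Longrightarrow> a \<le> h \<Longrightarrow> 0 \<le> b \<Longrightarrow> b \<le> h \<Longrightarrow> p + a *\<^sub>R v + b *\<^sub>R w \<in> S"
  obtains a b where "0 < a" "a < h" "0 < b" "b < h"
    "f (p + h *\<^sub>R v + h *\<^sub>R w) - f (p + h *\<^sub>R v) - f (p + h *\<^sub>R w) + f p
      = h * h * dir_deriv w (dir_deriv v f) (p + a *\<^sub>R v + b *\<^sub>R w)"
proof -
  have C: "Ck_on (Suc (Suc 0)) S f" using assms(1) by (simp only: numeral_2_eq_2)
  have "((\<lambda>s. f ((p + h *\<^sub>R w) + s *\<^sub>R v) - f (p + s *\<^sub>R v)) has_real_derivative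
      dir_deriv v f ((p + h *\<^sub>R w) + s *\<^sub>R v) - dir_deriv v f (p + s *\<^sub>R v)) (at s)"
    if "0 \<le> s" "s \<le> h" for s
    using that S[of s h] S[of s 0] assms(2)
    by (intro DERIV_diff has_field_derivative_along Ck_on_has_derivative[OF C])
       (simp_all add: algebra_simps)
  from MVT2[OF assms(2) this] obtain a where a: "0 < a" "a < h"
    and 1: "f (p + h *\<^sub>R w + h *\<^sub>R v) - f (p + h *\<^sub>R v) - (f (p + h *\<^sub>R w) - f p)
      = h * (dir_deriv v f (p + h *\<^sub>R w + a *\<^sub>R v) - dir_deriv v f (p + a *\<^sub>R v))"
    by auto
  have C': "Ck_on (Suc 0) S (dir_deriv v f)" using C by simp
  have "((\<lambda>s. dir_deriv v f ((p + a *\<^sub>R v) + s *\<^sub>R w)) has_real_derivative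
      dir_deriv w (dir_deriv v f) ((p + a *\<^sub>R v) + s *\<^sub>R w)) (at s)"
    if "0 \<le> s" "s \<le> h" for s
    using that S[of a s] a
    by (intro has_field_derivative_along Ck_on_has_derivative[OF C']) simp
  from MVT2[OF assms(2) this] obtain b where b: "0 < b" "b < h"
    and 2: "dir_deriv v f (p + a *\<^sub>R v + h *\<^sub>R w) - dir_deriv v f (p + a *\<^sub>R v)
      = h * dir_deriv w (dir_deriv v f) (p + a *\<^sub>R v + b *\<^sub>R w)"
    by auto
  have "p + h *\<^sub>R w + a *\<^sub>R v = p + a *\<^sub>R v + h *\<^sub>R w"
    "p + h *\<^sub>R w + h *\<^sub>R v = p + h *\<^sub>R v + h *\<^sub>R w" by simp_all
  with 1 2 have "f (p + h *\<^sub>R v + h *\<^sub>R w) - f (p + h *\<^sub>R v) - f (p + h *\<^sub>R w) + f p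
      = h * h * dir_deriv w (dir_deriv v f) (p + a *\<^sub>R v + b *\<^sub>R w)"
    by simp
  with a b that show ?thesis by blast
qed

text \<open>The second difference over the parallelogram spanned by h v and h w is symmetric in v
  and w. The mean value theorem, applied in either order, therefore gives the two mixed derivatives
  a common value at points close to p, and continuity does the rest.\<close>

lemma dir_deriv_commute:
  assumes "open S" "Ck_on 2 S f" "p \<in> S"
  shows "dir_deriv v (dir_deriv w f) p = dir_deriv w (dir_deriv v f) p"
proof (rule ccontr)
  define A where "A = dir_deriv v (dir_deriv w f)"
  define B where "B = dir_deriv w (dir_deriv v f)"
  assume "\<not> ?thesis"
  then have ne: "A p \<noteq> B p" by (simp add: A_def B_def)
  \<comment> \<open>Half the gap: a value strictly within e of \<open>A p\<close> cannot equal one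
    strictly within e of \<open>B p\<close>.\<close>
  define e where "e = \<bar>A p - B p\<bar> / 2"
  have e: "e > 0" using ne by (simp add: e_def)
  have "continuous_on S A" "continuous_on S B"
    using assms(2) by (simp_all add: A_def B_def numeral_2_eq_2)
  then have "isCont A p" "isCont B p"
    using assms(1,3) by (simp_all add: continuous_on_eq_continuous_at)
  then obtain r1 r2 where r1: "r1 > 0" "\<And>q. dist q p < r1 \<Longrightarrow> dist (A q) (A p) < e"
    and r2: "r2 > 0" "\<And>q. dist q p < r2 \<Longrightarrow> dist (B q) (B p) < e"
    using e unfolding continuous_at_eps_delta by (metis dist_commute)
  obtain r3 where r3: "r3 > 0" "ball p r3 \<subseteq> S"
    using assms(1,3) open_contains_ball by blast
  define r where "r = min r1 (min r2 r3)"
  have r: "r > 0" using r1 r2 r3 by (simp add: r_def)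
  \<comment> \<open>Small enough for the whole parallelogram to stay within distance r of p; the 1
    covers v = w = 0.\<close>
  define h where "h = r / (norm v + norm w + 1)"
  have nn: "norm v + norm w + 1 > 0" by (simp add: add_nonneg_pos)
  have h: "h > 0" using r nn by (simp add: h_def)
  have small: "dist (p + a *\<^sub>R v + b *\<^sub>R w) p < r"
    if "0 \<le> a" "a \<le> h" "0 \<le> b" "b \<le> h" for a b
  proof -
    have "norm (a *\<^sub>R v + b *\<^sub>R w) \<le> a * norm v + b * norm w"
      using norm_triangle_ineq[of "a *\<^sub>R v" "b *\<^sub>R w"] that by simp
    also have "\<dots> \<le> h * norm v + h * norm w"
      using that by (intro add_mono mult_right_mono) auto
    also have "\<dots> < h * (norm v + norm w + 1)" using h by (simp add: algebra_simps)
    also have "\<dots> = r" using nn by (simp add: h_def)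
    finally show ?thesis by (simp add: dist_norm algebra_simps)
  qed
  have S: "p + a *\<^sub>R v + b *\<^sub>R w \<in> S"
    if "0 \<le> a" "a \<le> h" "0 \<le> b" "b \<le> h" for a b
    using small[OF that] r3 by (auto simp: r_def dist_commute)
  have S': "p + a *\<^sub>R w + b *\<^sub>R v \<in> S"
    if "0 \<le> a" "a \<le> h" "0 \<le> b" "b \<le> h" for a b
    using S[OF that(3,4,1,2)] by (simp add: algebra_simps)
  obtain a b where ab: "0 < a" "a < h" "0 < b" "b < h"
    "f (p + h *\<^sub>R v + h *\<^sub>R w) - f (p + h *\<^sub>R v) - f (p + h *\<^sub>R w) + f p
      = h * h * B (p + a *\<^sub>R v + b *\<^sub>R w)"
    using second_difference_mean_value[OF assms(2) h S] unfolding B_def by blast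
  obtain c d where cd: "0 < c" "c < h" "0 < d" "d < h"
    "f (p + h *\<^sub>R w + h *\<^sub>R v) - f (p + h *\<^sub>R w) - f (p + h *\<^sub>R v) + f p
      = h * h * A (p + c *\<^sub>R w + d *\<^sub>R v)"
    using second_difference_mean_value[OF assms(2) h S'] unfolding A_def by blast
  have sw: "p + h *\<^sub>R w + h *\<^sub>R v = p + h *\<^sub>R v + h *\<^sub>R w"
    "p + c *\<^sub>R w + d *\<^sub>R v = p + d *\<^sub>R v + c *\<^sub>R w" by simp_all
  have "h * h * A (p + d *\<^sub>R v + c *\<^sub>R w) = h * h * B (p + a *\<^sub>R v + b *\<^sub>R w)"
    using ab(5) cd(5) unfolding sw by linarith
  then have "A (p + d *\<^sub>R v + c *\<^sub>R w) = B (p + a *\<^sub>R v + b *\<^sub>R w)" using h by simp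
  moreover have "dist (A (p + d *\<^sub>R v + c *\<^sub>R w)) (A p) < e"
    using small[of d c] cd by (intro r1) (auto simp: r_def)
  moreover have "dist (B (p + a *\<^sub>R v + b *\<^sub>R w)) (B p) < e"
    using small[of a b] ab by (intro r2) (auto simp: r_def)
  ultimately show False unfolding e_def dist_real_def by (smt (verit) field_sum_of_halves)
qed

subsection \<open>Kernels of powers of a lowering operator\<close>

text \<open>Functions are total but meaningful on an open set only, so an operator is required to
  depend on its argument locally. Linearity is restricted to smooth arguments, since
  \<open>dir_deriv\<close> is arbitrary where a function is not differentiable.\<close>

definition local_linear :: "((pt \<Rightarrow> real) \<Rightarrow> pt \<Rightarrow> real) \<Rightarrow> bool" where
  "local_linear X \<longleftrightarrow> (\<forall>S f. open S \<longrightarrow> smooth_on S f \<longrightarrow> smooth_on S (X f)) \<and>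
     (\<forall>S f g p. open S \<longrightarrow> (\<forall>q\<in>S. f q = g q) \<longrightarrow> p \<in> S \<longrightarrow> X f p = X g p) \<and>
     (\<forall>S f g r p. open S \<longrightarrow> smooth_on S f \<longrightarrow> smooth_on S g \<longrightarrow> p \<in> S \<longrightarrow>
        X (\<lambda>q. f q + r * g q) p = X f p + r * X g p)"

context
  fixes X :: "(pt \<Rightarrow> real) \<Rightarrow> pt \<Rightarrow> real"
  assumes X: "local_linear X"
begin

lemma local_linear_smooth: "open S \<Longrightarrow> smooth_on S f \<Longrightarrow> smooth_on S (X f)"
  using X[unfolded local_linear_def, THEN conjunct1] by (elim allE impE)

lemma local_linear_cong:
  assumes "open S" "p \<in> S" "\<And>q. q \<in> S \<Longrightarrow> f q = g q"
  shows "X f p = X g p"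
  by (rule X[unfolded local_linear_def, THEN conjunct2, THEN conjunct1, rule_format, OF assms(1) _ assms(2)])
     (rule assms(3))

lemma local_linear_add_scale:
  assumes "open S" "smooth_on S f" "smooth_on S g" "p \<in> S"
  shows "X (\<lambda>q. f q + r * g q) p = X f p + r * X g p"
  by (rule X[unfolded local_linear_def, THEN conjunct2, THEN conjunct2, rule_format, OF assms])

lemma local_linear_zero: "X (\<lambda>_. 0) p = 0"
proof -
  have "X (\<lambda>q. 0 + (-1) * 0) p = X (\<lambda>_. 0) p + (-1) * X (\<lambda>_. 0) p"
    by (rule local_linear_add_scale[OF open_UNIV smooth_on_const smooth_on_const UNIV_I])
  then show ?thesis by simp
qed

lemma local_linear_vanish:
  assumes "open S" "p \<in> S" "\<And>q. q \<in> S \<Longrightarrow> f q = 0"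
  shows "X f p = 0"
  using local_linear_cong[OF assms] unfolding local_linear_zero .

lemma local_linear_scale:
  assumes "open S" "smooth_on S g" "p \<in> S"
  shows "X (\<lambda>q. r * g q) p = r * X g p"
  using local_linear_add_scale[OF assms(1) smooth_on_const assms(2,3), of 0 r]
  unfolding local_linear_zero by simp

lemma local_linear_sum:
  fixes n :: nat
  assumes "open S" "\<And>k. k < n \<Longrightarrow> smooth_on S (f k)" "p \<in> S"
  shows "X (\<lambda>q. \<Sum>k<n. f k q) p = (\<Sum>k<n. X (f k) p)"
  using assms(2)
proof (induction n)
  case 0
  then show ?case by (simp add: local_linear_zero)
next
  case (Suc n)
  have "smooth_on S (\<lambda>q. \<Sum>k<n. f k q)" using Suc.prems assms(1) by (intro smooth_on_sum) auto
  from local_linear_add_scale[OF assms(1) this _ assms(3), of "f n" 1] Suc.prems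
  have "X (\<lambda>q. \<Sum>k<Suc n. f k q) p = X (\<lambda>q. \<Sum>k<n. f k q) p + X (f n) p"
    by (simp only: sum.lessThan_Suc mult_1)
  also have "X (\<lambda>q. \<Sum>k<n. f k q) p = (\<Sum>k<n. X (f k) p)"
    by (rule Suc.IH) (simp add: Suc.prems)
  finally show ?case by simp
qed

end

lemma local_linear_funpow:
  assumes X: "local_linear X"
  shows "local_linear (X ^^ n)"
proof (induction n)
  case 0
  show ?case unfolding local_linear_def funpow_0 by blast
next
  case (Suc n)
  note Xn = local_linear_smooth[OF Suc] local_linear_cong[OF Suc] local_linear_add_scale[OF Suc]
  show ?case
    unfolding local_linear_def funpow.simps o_def
  proof (intro conjI allI impI)
    fix S :: "pt set" and f :: "pt \<Rightarrow> real" assume "open S" "smooth_on S f"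
    then show "smooth_on S (X ((X ^^ n) f))"
      by (intro local_linear_smooth[OF X] Xn(1))
  next
    fix S :: "pt set" and f g :: "pt \<Rightarrow> real" and p
    assume *: "open S" "\<forall>q\<in>S. f q = g q" "p \<in> S"
    then show "X ((X ^^ n) f) p = X ((X ^^ n) g) p"
      by (intro local_linear_cong[OF X *(1,3)] Xn(2)[OF *(1)]) auto
  next
    fix S :: "pt set" and f g :: "pt \<Rightarrow> real" and r p
    assume *: "open S" "smooth_on S f" "smooth_on S g" "p \<in> S"
    have "X ((X ^^ n) (\<lambda>q. f q + r * g q)) p = X (\<lambda>q. (X ^^ n) f q + r * (X ^^ n) g q) p"
      by (rule local_linear_cong[OF X *(1,4)]) (rule Xn(3)[OF *(1-3)])
    also have "\<dots> = X ((X ^^ n) f) p + r * X ((X ^^ n) g) p"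
      by (intro local_linear_add_scale[OF X *(1)] Xn(1) *)
    finally show "X ((X ^^ n) (\<lambda>q. f q + r * g q)) p = X ((X ^^ n) f) p + r * X ((X ^^ n) g) p" .
  qed
qed

lemma local_linear_funpow_smooth:
  "local_linear X \<Longrightarrow> open S \<Longrightarrow> smooth_on S f \<Longrightarrow> smooth_on S ((X ^^ n) f)"
  by (rule local_linear_smooth[OF local_linear_funpow])

lemma funpow_vanish:
  assumes "local_linear X" "open S" "\<And>q. q \<in> S \<Longrightarrow> X f q = 0" "n > 0" "p \<in> S"
  shows "(X ^^ n) f p = 0"
proof -
  obtain m where "n = Suc m" using assms(4) gr0_implies_Suc by blast
  then have "(X ^^ n) f = (X ^^ m) (X f)" by (simp add: funpow_swap1)
  then show ?thesis
    using local_linear_vanish[OF local_linear_funpow[OF assms(1)] assms(2,5,3)] by simp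
qed

text \<open>The canonical commutation relation of a lowering operator A and a raising operator B.
  The relations are pointwise identities on smooth functions over open sets, the only form in which
  differential operators satisfy them here.\<close>

locale ladder =
  fixes A B L :: "(pt \<Rightarrow> real) \<Rightarrow> pt \<Rightarrow> real" and c :: real
  assumes A: "local_linear A" and B: "local_linear B" and L: "local_linear L"
    and c: "c \<noteq> 0"
    and AB: "open S \<Longrightarrow> smooth_on S f \<Longrightarrow> p \<in> S \<Longrightarrow> A (B f) p = B (A f) p + c * f p"
    and LA: "open S \<Longrightarrow> smooth_on S f \<Longrightarrow> p \<in> S \<Longrightarrow> L (A f) p = A (L f) p"
    and LB: "open S \<Longrightarrow> smooth_on S f \<Longrightarrow> p \<in> S \<Longrightarrow> L (B f) p = B (L f) p"
begin

text \<open>Moving A past each of the k factors B costs one term c. For k = 0 the truncated exponent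
  k - 1 is harmless because its coefficient is zero.\<close>

lemma commute_power:
  assumes "open S" "smooth_on S f" "p \<in> S"
  shows "A ((B ^^ k) f) p = (B ^^ k) (A f) p + (real k * c) * (B ^^ (k - 1)) f p"
  using assms(3)
proof (induction k arbitrary: p)
  case (Suc k)
  have sm: "smooth_on S ((B ^^ j) g)" if "smooth_on S g" for j g
    by (rule local_linear_funpow_smooth[OF B assms(1) that])
  have 1: "A ((B ^^ Suc k) f) p = B (A ((B ^^ k) f)) p + c * (B ^^ k) f p"
    using AB[OF assms(1) sm[OF assms(2)] Suc.prems] by simp
  have 2: "B (A ((B ^^ k) f)) p
      = B (\<lambda>q. (B ^^ k) (A f) q + (real k * c) * (B ^^ (k - 1)) f q) p"
    using Suc by (intro local_linear_cong[OF B assms(1)]) auto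
  have 3: "B (\<lambda>q. (B ^^ k) (A f) q + (real k * c) * (B ^^ (k - 1)) f q) p
      = B ((B ^^ k) (A f)) p + (real k * c) * B ((B ^^ (k - 1)) f) p"
    using Suc.prems assms(1)
    by (intro local_linear_add_scale[OF B, of S] sm local_linear_smooth[OF A] assms(2)) auto
  \<comment> \<open>For k = 0 the two functions differ, but both are multiplied by zero.\<close>
  have 4: "(real k * c) * B ((B ^^ (k - 1)) f) p = (real k * c) * (B ^^ k) f p"
    by (cases k) simp_all
  have 5: "A ((B ^^ Suc k) f) p = B ((B ^^ k) (A f)) p + (real k * c + c) * (B ^^ k) f p"
    unfolding 1 2 3 4 by algebra
  have 6: "(B ^^ Suc k) (A f) p = B ((B ^^ k) (A f)) p" by simp
  have 7: "real (Suc k) * c = real k * c + c" by (simp add: algebra_simps)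
  show ?case unfolding 5 6 7 diff_Suc_1 ..
qed simp

lemma lower_power:
  assumes "open S" "smooth_on S f" "\<And>q. q \<in> S \<Longrightarrow> A f q = 0" "p \<in> S"
  shows "(A ^^ n) ((B ^^ n) f) p = c ^ n * fact n * f p"
  using assms(4)
proof (induction n arbitrary: p)
  case (Suc n)
  have sm: "smooth_on S ((B ^^ n) f)"
    by (rule local_linear_funpow_smooth[OF B assms(1,2)])
  have "A ((B ^^ Suc n) f) q = (real (Suc n) * c) * (B ^^ n) f q" if q: "q \<in> S" for q
    using commute_power[OF assms(1,2) q, of "Suc n"]
      local_linear_vanish[OF local_linear_funpow[OF B, of "Suc n"] assms(1) q assms(3)] by simp
  then have "(A ^^ n) (A ((B ^^ Suc n) f)) p = (A ^^ n) (\<lambda>q. (real (Suc n) * c) * (B ^^ n) f q) p"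
    by (intro local_linear_cong[OF local_linear_funpow[OF A] assms(1) Suc.prems])
  also have "\<dots> = (real (Suc n) * c) * (A ^^ n) ((B ^^ n) f) p"
    by (rule local_linear_scale[OF local_linear_funpow[OF A] assms(1) sm Suc.prems])
  finally show ?case using Suc by (simp add: funpow_swap1 algebra_simps)
qed simp

text \<open>Already A^k reduces B^k f to a multiple of f, and at least one more factor A is left to
  kill it.\<close>

lemma lower_power_less:
  assumes "open S" "smooth_on S f" "\<And>q. q \<in> S \<Longrightarrow> A f q = 0" "k < n" "p \<in> S"
  shows "(A ^^ n) ((B ^^ k) f) p = 0"
proof -
  obtain m where n: "n = Suc m + k" using assms(4) less_imp_Suc_add by (metis add.commute add_Suc_right)
  have "(A ^^ n) ((B ^^ k) f) p = (A ^^ Suc m) ((A ^^ k) ((B ^^ k) f)) p"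
    by (simp only: n funpow_add o_def)
  also have "\<dots> = (A ^^ Suc m) (\<lambda>q. (c ^ k * fact k) * f q) p"
    using lower_power[OF assms(1-3)]
    by (intro local_linear_cong[OF local_linear_funpow[OF A] assms(1,5)])
  also have "\<dots> = (c ^ k * fact k) * (A ^^ Suc m) f p"
    by (rule local_linear_scale[OF local_linear_funpow[OF A] assms(1,2,5)])
  also have "(A ^^ Suc m) f p = 0"
    by (rule funpow_vanish[OF A assms(1,3) _ assms(5)]) auto
  finally show ?thesis by simp
qed

text \<open>Stated for an arbitrary X because it serves for A and for B alike.\<close>

lemma commutes_power:
  assumes X: "local_linear X"
    and LX: "\<And>f p. smooth_on S f \<Longrightarrow> p \<in> S \<Longrightarrow> L (X f) p = X (L f) p"
    and S: "open S" "smooth_on S f" "p \<in> S"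
  shows "L ((X ^^ n) f) p = (X ^^ n) (L f) p"
  using S(3)
proof (induction n arbitrary: p)
  case (Suc n)
  have "L ((X ^^ Suc n) f) p = X (L ((X ^^ n) f)) p"
    using LX[OF local_linear_funpow_smooth[OF X S(1,2)] Suc.prems] by simp
  also have "\<dots> = X ((X ^^ n) (L f)) p"
    by (rule local_linear_cong[OF X S(1) Suc.prems Suc.IH])
  also have "\<dots> = (X ^^ Suc n) (L f) p" by simp
  finally show ?case .
qed simp

lemma L_power_vanish:
  assumes "open S" "smooth_on S f" "\<And>q. q \<in> S \<Longrightarrow> L f q = 0" "p \<in> S"
  shows "L ((A ^^ n) f) p = 0" "L ((B ^^ n) f) p = 0"
proof -
  have "L ((A ^^ n) f) p = (A ^^ n) (L f) p"
    by (rule commutes_power[OF A LA[OF assms(1)] assms(1,2,4)])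
  then show "L ((A ^^ n) f) p = 0"
    using local_linear_vanish[OF local_linear_funpow[OF A] assms(1,4,3)] by simp
  have "L ((B ^^ n) f) p = (B ^^ n) (L f) p"
    by (rule commutes_power[OF B LB[OF assms(1)] assms(1,2,4)])
  then show "L ((B ^^ n) f) p = 0"
    using local_linear_vanish[OF local_linear_funpow[OF B] assms(1,4,3)] by simp
qed

text \<open>Peels off the top component. If A^(n+1) u = 0, then A^n u lies in ker A; with f the
  multiple of it chosen below, A^n B^n f = A^n u by \<open>lower_power\<close>. Hence u - B^n f is
  killed by A^n, still solves the equation, and the induction hypothesis applies.\<close>

lemma kernel_power_decomposition:
  assumes "open S" "smooth_on S u" "\<And>q. q \<in> S \<Longrightarrow> L u q = 0" "\<And>q. q \<in> S \<Longrightarrow> (A ^^ n) u q = 0"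
  shows "\<exists>v. (\<forall>k<n. smooth_on S (v k) \<and> (\<forall>q\<in>S. A (v k) q = 0 \<and> L (v k) q = 0)) \<and>
    (\<forall>q\<in>S. u q = (\<Sum>k<n. (B ^^ k) (v k) q))"
  using assms(2-4)
proof (induction n arbitrary: u)
  case (Suc n)
  \<comment> \<open>The inverse of the factor in \<open>lower_power\<close>, which is nonzero since
    c is.\<close>
  define r where "r = 1 / (c ^ n * fact n)"
  define f where "f = (\<lambda>q. r * (A ^^ n) u q)"
  have smA: "smooth_on S ((A ^^ n) u)"
    by (rule local_linear_funpow_smooth[OF A assms(1) Suc.prems(1)])
  have smf: "smooth_on S f" unfolding f_def by (intro smooth_on_cmult smA assms(1))
  have Af: "A f q = 0" if "q \<in> S" for q
    using local_linear_scale[OF A assms(1) smA that, of r] Suc.prems(3)[OF that]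
    by (simp add: f_def)
  have Lf: "L f q = 0" if "q \<in> S" for q
    using local_linear_scale[OF L assms(1) smA that, of r]
      L_power_vanish(1)[OF assms(1) Suc.prems(1,2) that] by (simp add: f_def)
  have smB: "smooth_on S ((B ^^ n) f)"
    by (rule local_linear_funpow_smooth[OF B assms(1) smf])
  define u' where "u' = (\<lambda>q. u q + (-1) * (B ^^ n) f q)"
  have "smooth_on S u'"
    unfolding u'_def by (intro smooth_on_add smooth_on_cmult Suc.prems(1) smB assms(1))
  moreover have "L u' q = 0" if "q \<in> S" for q
    using local_linear_add_scale[OF L assms(1) Suc.prems(1) smB that, of "-1"]
      Suc.prems(2)[OF that] L_power_vanish(2)[OF assms(1) smf Lf that]
    by (simp add: u'_def)
  moreover have "(A ^^ n) u' q = 0" if "q \<in> S" for q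
  proof -
    have "(A ^^ n) u' q = (A ^^ n) u q - (A ^^ n) ((B ^^ n) f) q"
      using local_linear_add_scale[OF local_linear_funpow[OF A, of n] assms(1) Suc.prems(1) smB that, of "-1"]
      by (simp add: u'_def)
    also have "(A ^^ n) ((B ^^ n) f) q = (c ^ n * fact n) * f q"
      by (rule lower_power[OF assms(1) smf Af that])
    finally show ?thesis using c by (simp add: f_def r_def)
  qed
  ultimately obtain v where v: "\<forall>k<n. smooth_on S (v k) \<and> (\<forall>q\<in>S. A (v k) q = 0 \<and> L (v k) q = 0)"
    "\<forall>q\<in>S. u' q = (\<Sum>k<n. (B ^^ k) (v k) q)"
    using Suc.IH by blast
  have "u q = (\<Sum>k<Suc n. (B ^^ k) ((v(n := f)) k) q)" if "q \<in> S" for q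
    using v(2) that by (simp add: u'_def diff_eq_eq)
  then show ?case
    using v(1) smf Af Lf by (intro exI[of _ "v(n := f)"]) (auto simp: less_Suc_eq)
qed simp

end

section \<open>From the common kernel to local representations\<close>

definition kolmogorov :: "(pt \<Rightarrow> real) \<Rightarrow> pt \<Rightarrow> real" where
  "kolmogorov u = (\<lambda>p. Dt u p + fst (snd p) * Dy u p - Dx (Dx u) p)"

lemma solution_iff:
  "solution \<Omega> u \<longleftrightarrow> open \<Omega> \<and> smooth_on \<Omega> u \<and> (\<forall>p\<in>\<Omega>. kolmogorov u p = 0)"
  unfolding solution_def kolmogorov_def by auto

lemma heat_solution_subset:
  "heat_solution V \<theta> \<Longrightarrow> open W \<Longrightarrow> W \<subseteq> V \<Longrightarrow> heat_solution W \<theta>"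
  unfolding heat_solution_def using smooth_on_subset by blast

context ladder
begin

text \<open>A particular family enters only through \<open>reduce\<close> (every w \<theta>(z) lies
  in the common kernel of A and L) and \<open>lift\<close> (locally the common kernel contains
  nothing else). The decomposition of ker A^n supplies the forward direction, and the vanishing of
  A^n B^k on ker A for k < n the converse.\<close>

theorem invariant_iff_represented:
  assumes L_eq: "L = kolmogorov" and "open \<Omega>" "\<Omega> \<subseteq> D"
    and reduce: "\<And>U V \<theta>. open U \<Longrightarrow> U \<subseteq> D \<Longrightarrow> z ` U \<subseteq> V \<Longrightarrow> heat_solution V \<theta> \<Longrightarrow>
        smooth_on U (\<lambda>r. w r * \<theta> (z r)) \<and>
        (\<forall>q\<in>U. A (\<lambda>r. w r * \<theta> (z r)) q = 0 \<and> L (\<lambda>r. w r * \<theta> (z r)) q = 0)"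
    and lift: "\<And>v p. smooth_on \<Omega> v \<Longrightarrow> (\<And>q. q \<in> \<Omega> \<Longrightarrow> A v q = 0 \<and> L v q = 0) \<Longrightarrow> p \<in> \<Omega> \<Longrightarrow>
        \<exists>U V \<theta>. open U \<and> p \<in> U \<and> U \<subseteq> \<Omega> \<and> z ` U \<subseteq> V \<and> heat_solution V \<theta> \<and>
          (\<forall>q\<in>U. v q = w q * \<theta> (z q))"
  shows "invariant_solution \<Omega> (A ^^ n) u \<longleftrightarrow> locally_represented \<Omega> n B w z u"
proof
  assume "invariant_solution \<Omega> (A ^^ n) u"
  then have "smooth_on \<Omega> u" "\<And>q. q \<in> \<Omega> \<Longrightarrow> L u q = 0" "\<And>q. q \<in> \<Omega> \<Longrightarrow> (A ^^ n) u q = 0"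
    by (auto simp: invariant_solution_def solution_iff L_eq)
  from kernel_power_decomposition[OF assms(2) this] obtain v where
    v: "\<And>k. k < n \<Longrightarrow> smooth_on \<Omega> (v k)"
      "\<And>k q. k < n \<Longrightarrow> q \<in> \<Omega> \<Longrightarrow> A (v k) q = 0 \<and> L (v k) q = 0"
    and u: "\<And>q. q \<in> \<Omega> \<Longrightarrow> u q = (\<Sum>k<n. (B ^^ k) (v k) q)" by blast
  show "locally_represented \<Omega> n B w z u"
    unfolding locally_represented_def
  proof
    fix p assume p: "p \<in> \<Omega>"
    define rep where "rep k U V \<theta> \<longleftrightarrow> open U \<and> p \<in> U \<and> U \<subseteq> \<Omega> \<and> z ` U \<subseteq> V \<and>
      heat_solution V \<theta> \<and> (\<forall>q\<in>U. v k q = w q * \<theta> (z q))" for k U V \<theta>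
    have "\<exists>U V \<theta>. rep k U V \<theta>" if "k < n" for k
      unfolding rep_def using lift[OF v(1)[OF that] v(2)[OF that] p] by blast
    then obtain U V \<theta> where "\<And>k. k < n \<Longrightarrow> rep k (U k) (V k) (\<theta> k)"
      by metis
    note k = this[unfolded rep_def]
    \<comment> \<open>Each component comes with its own neighbourhood, and there are finitely many.
      The factor \<Omega> keeps \<open>U'\<close> inside \<Omega> also for n = 0, where the
      intersection over k is everything.\<close>
    define U' where "U' = \<Omega> \<inter> (\<Inter>k<n. U k)"
    define V' where "V' = (\<Inter>k<n. V k)"
    have U': "open U'" unfolding U'_def using k assms(2) by (intro open_Int open_INT) auto
    have V': "open V'" unfolding V'_def
      using k by (intro open_INT) (auto simp: heat_solution_def)
    have sub: "U' \<subseteq> U k" if "k < n" for k using that by (auto simp: U'_def)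
    have "u q = (\<Sum>k<n. (B ^^ k) (\<lambda>r. w r * \<theta> k (z r)) q)" if q: "q \<in> U'" for q
    proof -
      \<comment> \<open>The functions agree on \<open>U'\<close> only; this suffices because B^k is
        local.\<close>
      have "(B ^^ k) (v k) q = (B ^^ k) (\<lambda>r. w r * \<theta> k (z r)) q" if "k < n" for k
        by (rule local_linear_cong[OF local_linear_funpow[OF B] U' q]) (use k[OF that] sub[OF that] in blast)
      then show ?thesis using u q by (simp add: U'_def)
    qed
    moreover have "heat_solution V' (\<theta> k)" if "k < n" for k
      using k[OF that] that by (intro heat_solution_subset[OF _ V']) (auto simp: V'_def)
    moreover have "z ` U' \<subseteq> V'" using k by (fastforce simp: U'_def V'_def)
    moreover have "p \<in> U'" "U' \<subseteq> \<Omega>" using k p by (auto simp: U'_def)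
    ultimately show "\<exists>U V \<theta>. open U \<and> p \<in> U \<and> U \<subseteq> \<Omega> \<and> z ` U \<subseteq> V \<and> (\<forall>k<n. heat_solution V (\<theta> k)) \<and>
        (\<forall>q\<in>U. u q = (\<Sum>k<n. (B ^^ k) (\<lambda>r. w r * \<theta> k (z r)) q))"
      using U' by blast
  qed
next
  assume rep: "locally_represented \<Omega> n B w z u"
  \<comment> \<open>Smoothness, the equation and invariance are all local properties, so each may be
    checked on a neighbourhood where the representation holds.\<close>
  have loc: "\<exists>U. open U \<and> p \<in> U \<and> smooth_on U u \<and> L u p = 0 \<and> (A ^^ n) u p = 0" if p: "p \<in> \<Omega>" for p
  proof -
    from rep[unfolded locally_represented_def, rule_format, OF p]
    obtain U V \<theta> where U: "open U" "p \<in> U" "U \<subseteq> \<Omega>" "z ` U \<subseteq> V"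
      and heat': "\<forall>k<n. heat_solution V (\<theta> k)"
      and u'': "\<forall>q\<in>U. u q = (\<Sum>k<n. (B ^^ k) (\<lambda>r. w r * \<theta> k (z r)) q)"
      by (elim exE conjE)
    note heat = heat'[rule_format] and u = u''[rule_format]
    define v where "v k = (\<lambda>r. w r * \<theta> k (z r))" for k
    have "U \<subseteq> D" using U(3) assms(3) by blast
    note r = reduce[OF U(1) this U(4) heat, folded v_def]
    have v: "smooth_on U (v k)" "\<And>q. q \<in> U \<Longrightarrow> A (v k) q = 0" "\<And>q. q \<in> U \<Longrightarrow> L (v k) q = 0"
      if "k < n" for k
      using r[OF that] by blast+
    have sm: "smooth_on U ((B ^^ k) (v k))" if "k < n" for k
      by (rule local_linear_funpow_smooth[OF B U(1) v(1)[OF that]])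
    have u': "u q = (\<Sum>k<n. (B ^^ k) (v k) q)" if "q \<in> U" for q
      using u[OF that] by (simp add: v_def)
    have "smooth_on U (\<lambda>q. \<Sum>k<n. (B ^^ k) (v k) q)"
      using sm by (intro smooth_on_sum U) auto
    then have "smooth_on U u" by (subst smooth_on_cong[OF U(1) u'])
    moreover have "L u p = 0"
    proof -
      have "L u p = L (\<lambda>q. \<Sum>k<n. (B ^^ k) (v k) q) p"
        by (rule local_linear_cong[OF L U(1,2) u'])
      also have "\<dots> = (\<Sum>k<n. L ((B ^^ k) (v k)) p)"
        by (rule local_linear_sum[OF L U(1) sm U(2)])
      also have "\<dots> = 0"
        using L_power_vanish(2)[OF U(1) v(1,3) U(2)] by (intro sum.neutral) auto
      finally show ?thesis .
    qed
    moreover have "(A ^^ n) u p = 0"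
    proof -
      have "(A ^^ n) u p = (A ^^ n) (\<lambda>q. \<Sum>k<n. (B ^^ k) (v k) q) p"
        by (rule local_linear_cong[OF local_linear_funpow[OF A] U(1,2) u'])
      also have "\<dots> = (\<Sum>k<n. (A ^^ n) ((B ^^ k) (v k)) p)"
        by (rule local_linear_sum[OF local_linear_funpow[OF A] U(1) sm U(2)])
      also have "\<dots> = 0"
        using lower_power_less[OF U(1) v(1,2) _ U(2)] by (intro sum.neutral) auto
      finally show ?thesis .
    qed
    ultimately show ?thesis using U(1,2) by (intro exI[of _ U] conjI)
  qed
  have "smooth_on \<Omega> u"
  proof (rule smooth_on_local)
    fix p assume "p \<in> \<Omega>"
    from loc[OF this] show "\<exists>U. open U \<and> p \<in> U \<and> smooth_on U u" by (elim exE conjE) (intro exI conjI)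
  qed
  moreover have "kolmogorov u p = 0 \<and> (A ^^ n) u p = 0" if "p \<in> \<Omega>" for p
    using loc[OF that] unfolding L_eq by (elim exE conjE) (intro conjI)
  ultimately show "invariant_solution \<Omega> (A ^^ n) u"
    using assms(2) unfolding invariant_solution_def solution_iff by (intro conjI ballI) auto
qed

end

subsection \<open>First-order symmetry operators\<close>

lemma local_linearI:
  assumes "\<And>S f. open S \<Longrightarrow> smooth_on S f \<Longrightarrow> smooth_on S (X f)"
    and "\<And>S f g p. open S \<Longrightarrow> (\<And>q. q \<in> S \<Longrightarrow> f q = g q) \<Longrightarrow> p \<in> S \<Longrightarrow> X f p = X g p"
    and "\<And>S f g r p. open S \<Longrightarrow> smooth_on S f \<Longrightarrow> smooth_on S g \<Longrightarrow> p \<in> S \<Longrightarrow>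
        X (\<lambda>q. f q + r * g q) p = X f p + r * X g p"
  shows "local_linear X"
  unfolding local_linear_def
proof (intro conjI allI impI)
  fix S :: "pt set" and f g :: "pt \<Rightarrow> real" and p
  assume "open S" "\<forall>q\<in>S. f q = g q" "p \<in> S"
  then show "X f p = X g p" by (intro assms(2)[of S]) auto
qed (rule assms; assumption)+

lemma dir_deriv_add_scale:
  assumes "smooth_on S f" "smooth_on S g" "p \<in> S"
  shows "dir_deriv v (\<lambda>q. f q + r * g q) p = dir_deriv v f p + r * dir_deriv v g p"
  by (rule dir_deriv_eq, intro has_derivative_add has_derivative_mult_right)
     (use assms smooth_on_has_derivative in blast)+

lemma local_linear_dir_deriv: "local_linear (dir_deriv v)"
  by (rule local_linearI[OF smooth_on_dir_deriv dir_deriv_cong dir_deriv_add_scale])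

lemma local_linear_id: "local_linear (\<lambda>f. f)"
  by (rule local_linearI) auto

lemma local_linear_compose:
  assumes "local_linear X" "local_linear Y"
  shows "local_linear (\<lambda>f. X (Y f))"
proof (rule local_linearI)
  fix S :: "pt set" and f g :: "pt \<Rightarrow> real" and r p
  assume *: "open S" "smooth_on S f" "smooth_on S g" "p \<in> S"
  have "X (Y (\<lambda>q. f q + r * g q)) p = X (\<lambda>q. Y f q + r * Y g q) p"
    by (rule local_linear_cong[OF assms(1) *(1,4)]) (rule local_linear_add_scale[OF assms(2) *(1-3)])
  also have "\<dots> = X (Y f) p + r * X (Y g) p"
    by (rule local_linear_add_scale[OF assms(1) *(1) _ _ *(4)])
       (rule local_linear_smooth[OF assms(2) *(1)], rule *)+
  finally show "X (Y (\<lambda>q. f q + r * g q)) p = X (Y f) p + r * X (Y g) p" .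
next
  fix S :: "pt set" and f :: "pt \<Rightarrow> real"
  assume *: "open S" "smooth_on S f"
  show "smooth_on S (X (Y f))"
    by (rule local_linear_smooth[OF assms(1) *(1) local_linear_smooth[OF assms(2) *]])
next
  fix S :: "pt set" and f g :: "pt \<Rightarrow> real" and p
  assume *: "open S" "\<And>q. q \<in> S \<Longrightarrow> f q = g q" "p \<in> S"
  show "X (Y f) p = X (Y g) p"
    by (rule local_linear_cong[OF assms(1) *(1,3)]) (rule local_linear_cong[OF assms(2) *(1) _ *(2)])
qed

lemma local_linear_plus:
  assumes "local_linear X" "local_linear Y"
  shows "local_linear (\<lambda>f p. X f p + Y f p)"
proof (rule local_linearI)
  fix S :: "pt set" and f g :: "pt \<Rightarrow> real" and r p
  assume *: "open S" "smooth_on S f" "smooth_on S g" "p \<in> S"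
  show "X (\<lambda>q. f q + r * g q) p + Y (\<lambda>q. f q + r * g q) p = X f p + Y f p + r * (X g p + Y g p)"
    unfolding local_linear_add_scale[OF assms(1) *] local_linear_add_scale[OF assms(2) *]
    by (simp add: algebra_simps)
next
  fix S :: "pt set" and f :: "pt \<Rightarrow> real"
  assume *: "open S" "smooth_on S f"
  show "smooth_on S (\<lambda>p. X f p + Y f p)"
    by (rule smooth_on_add[OF *(1) local_linear_smooth[OF assms(1) *] local_linear_smooth[OF assms(2) *]])
next
  fix S :: "pt set" and f g :: "pt \<Rightarrow> real" and p
  assume *: "open S" "\<And>q. q \<in> S \<Longrightarrow> f q = g q" "p \<in> S"
  show "X f p + Y f p = X g p + Y g p"
    using local_linear_cong[OF assms(1) *(1,3,2)] local_linear_cong[OF assms(2) *(1,3,2)] by simp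
qed

lemma local_linear_coefficient:
  assumes "\<And>S. open S \<Longrightarrow> smooth_on S c" "local_linear X"
  shows "local_linear (\<lambda>f p. c p * X f p)"
proof (rule local_linearI)
  fix S :: "pt set" and f g :: "pt \<Rightarrow> real" and r p
  assume *: "open S" "smooth_on S f" "smooth_on S g" "p \<in> S"
  show "c p * X (\<lambda>q. f q + r * g q) p = c p * X f p + r * (c p * X g p)"
    unfolding local_linear_add_scale[OF assms(2) *] by (simp add: algebra_simps)
next
  fix S :: "pt set" and f :: "pt \<Rightarrow> real"
  assume *: "open S" "smooth_on S f"
  show "smooth_on S (\<lambda>p. c p * X f p)"
    by (rule smooth_on_mult[OF *(1) assms(1)[OF *(1)] local_linear_smooth[OF assms(2) *]])
next
  fix S :: "pt set" and f g :: "pt \<Rightarrow> real" and p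
  assume *: "open S" "\<And>q. q \<in> S \<Longrightarrow> f q = g q" "p \<in> S"
  show "c p * X f p = c p * X g p"
    using local_linear_cong[OF assms(2) *(1,3,2)] by simp
qed

lemma local_linear_kolmogorov: "local_linear kolmogorov"
proof -
  have "local_linear (\<lambda>u p. Dt u p + (fst (snd p) * Dy u p + (-1) * Dx (Dx u) p))"
    by (intro local_linear_plus local_linear_coefficient local_linear_dir_deriv
        smooth_on_fst_snd smooth_on_const local_linear_compose[of Dx Dx])
  moreover have "(\<lambda>u p. Dt u p + (fst (snd p) * Dy u p + (-1) * Dx (Dx u) p)) = kolmogorov"
    by (simp add: kolmogorov_def fun_eq_iff)
  ultimately show ?thesis by simp
qed

text \<open>The shape shared by \<open>P0\<close>, ..., \<open>P3\<close> and \<open>P2\<close> +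
  \<epsilon> \<open>P0\<close>: the derivatives are taken in x and y only, with coefficients
  depending on t alone.\<close>

definition sym_op ::
    "(real \<Rightarrow> real) \<Rightarrow> (real \<Rightarrow> real) \<Rightarrow> (real \<Rightarrow> real) \<Rightarrow> real \<Rightarrow> (pt \<Rightarrow> real) \<Rightarrow> pt \<Rightarrow> real" where
  "sym_op a b \<alpha> \<beta> f = (\<lambda>p. a (fst p) * Dx f p + b (fst p) * Dy f p
     + (\<alpha> (fst p) * fst (snd p) + \<beta> * snd (snd p)) * f p)"

lemma has_derivative_time:
  assumes "(c has_real_derivative d) (at (fst p))"
  shows "((\<lambda>p::pt. c (fst p)) has_derivative (\<lambda>v. fst v * d)) (at p)"
  using has_derivative_compose[OF has_derivative_fst[OF has_derivative_ident]
      assms[unfolded has_field_derivative_def]]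
  by (simp add: mult.commute)

lemma Ck_on_time:
  fixes S :: "pt set"
  assumes "open S" "\<And>p. p \<in> S \<Longrightarrow> (c has_real_derivative d (fst p)) (at (fst p))"
    and "Ck_on k S (\<lambda>p. d (fst p))"
  shows "Ck_on (Suc k) S (\<lambda>p. c (fst p))"
  by (rule Ck_on_SucI[OF assms(1) has_derivative_time[OF assms(2)]])
     (auto intro: Ck_on_mult[OF assms(1) Ck_on_const assms(3)])

lemma smooth_on_time:
  fixes S :: "pt set"
  assumes "open S" "\<And>p. p \<in> S \<Longrightarrow> (c has_real_derivative d (fst p)) (at (fst p))"
    and "smooth_on S (\<lambda>p. d (fst p))"
  shows "smooth_on S (\<lambda>p. c (fst p))"
  unfolding smooth_on_def
proof
  fix k show "Ck_on k S (\<lambda>p. c (fst p))"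
    by (rule Ck_on_SucD[OF Ck_on_time[OF assms(1,2) smooth_onD[OF assms(3)]]])
qed

text \<open>The determining equations of the first-order symmetry operators of the Kolmogorov equation.\<close>

locale symmetry =
  fixes a b \<alpha> :: "real \<Rightarrow> real" and \<beta> :: real
  assumes a: "(a has_real_derivative 2 * \<alpha> t) (at t)"
    and b: "(b has_real_derivative a t) (at t)"
    and \<alpha>: "(\<alpha> has_real_derivative - \<beta>) (at t)"
begin

lemma smooth_coefficients:
  assumes "open S"
  shows "smooth_on S (\<lambda>p::pt. a (fst p))" "smooth_on S (\<lambda>p::pt. b (fst p))"
    "smooth_on S (\<lambda>p::pt. \<alpha> (fst p))"
proof -
  show 1: "smooth_on S (\<lambda>p::pt. \<alpha> (fst p))"
    by (rule smooth_on_time[OF assms \<alpha> smooth_on_const])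
  show 2: "smooth_on S (\<lambda>p::pt. a (fst p))"
    by (rule smooth_on_time[OF assms a smooth_on_cmult[OF assms 1]])
  show "smooth_on S (\<lambda>p::pt. b (fst p))"
    by (rule smooth_on_time[OF assms b 2])
qed

lemma local_linear_sym_op: "local_linear (sym_op a b \<alpha> \<beta>)"
  unfolding sym_op_def
  by (intro local_linear_plus local_linear_coefficient local_linear_dir_deriv smooth_on_add
      smooth_on_mult smooth_on_cmult smooth_on_fst_snd smooth_on_snd_snd smooth_coefficients local_linear_id)

text \<open>The last two summands are the commutator with the derivative along v, that is, the
  derivatives of the coefficients, rewritten by the determining equations. The directions t, x and y
  give every commutator used below.\<close>

lemma dir_deriv_sym_op:
  assumes "open S" "smooth_on S f" "p \<in> S"
  shows "dir_deriv v (sym_op a b \<alpha> \<beta> f) p = sym_op a b \<alpha> \<beta> (dir_deriv v f) p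
    + fst v * (2 * \<alpha> (fst p) * Dx f p + a (fst p) * Dy f p - \<beta> * fst (snd p) * f p)
    + (\<alpha> (fst p) * fst (snd v) + \<beta> * snd (snd v)) * f p"
proof -
  have comm: "Dx (dir_deriv v f) p = dir_deriv v (Dx f) p" "Dy (dir_deriv v f) p = dir_deriv v (Dy f) p"
    by (rule dir_deriv_commute[OF assms(1) smooth_onD[OF assms(2)] assms(3)])+
  have "(sym_op a b \<alpha> \<beta> f has_derivative (\<lambda>v.
      (a (fst p) * dir_deriv v (Dx f) p + (fst v * (2 * \<alpha> (fst p))) * Dx f p)
      + (b (fst p) * dir_deriv v (Dy f) p + (fst v * a (fst p)) * Dy f p)
      + ((\<alpha> (fst p) * fst (snd p) + \<beta> * snd (snd p)) * dir_deriv v f p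
        + ((\<alpha> (fst p) * fst (snd v) + (fst v * (- \<beta>)) * fst (snd p)) + \<beta> * snd (snd v)) * f p))) (at p)"
    unfolding sym_op_def
    by (intro has_derivative_add has_derivative_mult has_derivative_mult_right has_derivative_time
        a b \<alpha> smooth_on_has_derivative[OF _ assms(3)] smooth_on_dir_deriv assms(2)
        has_derivative_fst has_derivative_snd has_derivative_ident)
  from dir_deriv_eq[OF this, of v] show ?thesis
    by (simp add: sym_op_def comm algebra_simps)
qed

text \<open>With M the operator, Dt M f leaves over 2 \<alpha> Dx f + a Dy f - \<beta> x f, x Dy M f
  leaves \<beta> x f, and Dx Dx M f leaves 2 \<alpha> Dx f. After cancellation a Dy f remains, which
  is exactly the commutator of M with multiplication by x, applied to Dy f.\<close>

lemma kolmogorov_commute: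
  assumes "open S" "smooth_on S f" "p \<in> S"
  shows "kolmogorov (sym_op a b \<alpha> \<beta> f) p = sym_op a b \<alpha> \<beta> (kolmogorov f) p"
proof -
  let ?M = "sym_op a b \<alpha> \<beta>"
  note sm = smooth_on_dir_deriv[OF assms(2)]
  note smM = local_linear_smooth[OF local_linear_sym_op assms(1)]
  have "Dx (Dx (?M f)) p = Dx (\<lambda>q. ?M (Dx f) q + \<alpha> (fst q) * f q) p"
    using dir_deriv_sym_op[OF assms(1,2), of _ "(0,1,0)"]
    by (intro dir_deriv_cong[OF assms(1,3)]) simp
  also have "Dx (\<lambda>q. ?M (Dx f) q + \<alpha> (fst q) * f q) p = Dx (?M (Dx f)) p + \<alpha> (fst p) * Dx f p"
  proof -
    have "((\<lambda>q. ?M (Dx f) q + \<alpha> (fst q) * f q) has_derivative (\<lambda>v. dir_deriv v (?M (Dx f)) p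
      + (\<alpha> (fst p) * dir_deriv v f p + (fst v * (- \<beta>)) * f p))) (at p)"
    by (intro has_derivative_add has_derivative_mult has_derivative_time \<alpha>
        smooth_on_has_derivative[OF _ assms(3)] smM sm assms(2))
    from dir_deriv_eq[OF this, of "(0,1,0)"] show ?thesis by simp
  qed
  also have "\<dots> = ?M (Dx (Dx f)) p + 2 * \<alpha> (fst p) * Dx f p"
    using dir_deriv_sym_op[OF assms(1) sm assms(3), of "(0,1,0)" "(0,1,0)"] by simp
  finally have xx: "Dx (Dx (?M f)) p = ?M (Dx (Dx f)) p + 2 * \<alpha> (fst p) * Dx f p" .
  have lhs: "kolmogorov (?M f) p = ?M (Dt f) p + fst (snd p) * ?M (Dy f) p
      + a (fst p) * Dy f p - ?M (Dx (Dx f)) p"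
    using dir_deriv_sym_op[OF assms, of "(1,0,0)"] dir_deriv_sym_op[OF assms, of "(0,0,1)"]
    by (simp add: kolmogorov_def xx algebra_simps)
  \<comment> \<open>The one term of the equation with a variable coefficient, the only one for which
    M does not simply pass through.\<close>
  define g where "g = (\<lambda>q. fst (snd q) * Dy f q)"
  have smg: "smooth_on S g" unfolding g_def
    by (intro smooth_on_mult smooth_on_fst_snd sm assms(1))
  have gd: "dir_deriv v g p = fst (snd p) * dir_deriv v (Dy f) p + fst (snd v) * Dy f p" for v
  proof -
    have "(g has_derivative (\<lambda>v. fst (snd p) * dir_deriv v (Dy f) p + fst (snd v) * Dy f p)) (at p)"
      unfolding g_def
      by (intro has_derivative_mult smooth_on_has_derivative[OF _ assms(3)] sm
        has_derivative_fst has_derivative_snd has_derivative_ident)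
    from dir_deriv_eq[OF this] show ?thesis .
  qed
  have Mg: "?M g p = fst (snd p) * ?M (Dy f) p + a (fst p) * Dy f p"
    using gd[of "(0,1,0)"] gd[of "(0,0,1)"] by (simp add: sym_op_def g_def algebra_simps)
  have "kolmogorov f = (\<lambda>q. (Dt f q + 1 * g q) + (-1) * Dx (Dx f) q)"
    by (simp add: kolmogorov_def g_def)
  then have "?M (kolmogorov f) p = ?M (\<lambda>q. (Dt f q + 1 * g q) + (-1) * Dx (Dx f) q) p" by simp
  also have "\<dots> = ?M (\<lambda>q. Dt f q + 1 * g q) p + (-1) * ?M (Dx (Dx f)) p"
    by (rule local_linear_add_scale[OF local_linear_sym_op assms(1) _ _ assms(3)])
       (intro smooth_on_add smooth_on_cmult sm smg assms(1) smooth_on_dir_deriv)+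
  also have "?M (\<lambda>q. Dt f q + 1 * g q) p = ?M (Dt f) p + 1 * ?M g p"
    by (rule local_linear_add_scale[OF local_linear_sym_op assms(1) sm smg assms(3)])
  finally show ?thesis using lhs Mg by simp
qed

end

text \<open>Neither operator differentiates in t, so the coefficients a and b act as constants. Only
  the zero-order parts, linear in x and y, are differentiated, and the commutator is multiplication
  by a function of t.\<close>

lemma sym_op_commutator:
  assumes "symmetry a b \<alpha> \<beta>" "symmetry a' b' \<alpha>' \<beta>'" and S: "open S" "smooth_on S f" "p \<in> S"
    and c: "a (fst p) * \<alpha>' (fst p) + b (fst p) * \<beta>' - a' (fst p) * \<alpha> (fst p) - b' (fst p) * \<beta> = c"
  shows "sym_op a b \<alpha> \<beta> (sym_op a' b' \<alpha>' \<beta>' f) p = sym_op a' b' \<alpha>' \<beta>' (sym_op a b \<alpha> \<beta> f) p + c * f p"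
proof -
  interpret s: symmetry a b \<alpha> \<beta> by (rule assms)
  interpret s': symmetry a' b' \<alpha>' \<beta>' by (rule assms)
  have comm: "Dy (Dx f) p = Dx (Dy f) p"
    by (rule dir_deriv_commute[OF S(1) smooth_onD[OF S(2)] S(3)])
  have 1: "sym_op a b \<alpha> \<beta> (sym_op a' b' \<alpha>' \<beta>' f) p
    = a (fst p) * Dx (sym_op a' b' \<alpha>' \<beta>' f) p + b (fst p) * Dy (sym_op a' b' \<alpha>' \<beta>' f) p
      + (\<alpha> (fst p) * fst (snd p) + \<beta> * snd (snd p)) * sym_op a' b' \<alpha>' \<beta>' f p"
    by (simp only: sym_op_def[of a])
  have 2: "sym_op a' b' \<alpha>' \<beta>' (sym_op a b \<alpha> \<beta> f) p
    = a' (fst p) * Dx (sym_op a b \<alpha> \<beta> f) p + b' (fst p) * Dy (sym_op a b \<alpha> \<beta> f) p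
      + (\<alpha>' (fst p) * fst (snd p) + \<beta>' * snd (snd p)) * sym_op a b \<alpha> \<beta> f p"
    by (simp only: sym_op_def[of a'])
  show ?thesis
    unfolding 1 2 s.dir_deriv_sym_op[OF S] s'.dir_deriv_sym_op[OF S]
    by (simp add: sym_op_def comm c[symmetric] algebra_simps)
qed

lemma ladder_sym_op:
  assumes "symmetry a b \<alpha> \<beta>" "symmetry a' b' \<alpha>' \<beta>'" "c \<noteq> 0"
    and "\<And>t. a t * \<alpha>' t + b t * \<beta>' - a' t * \<alpha> t - b' t * \<beta> = c"
  shows "ladder (sym_op a b \<alpha> \<beta>) (sym_op a' b' \<alpha>' \<beta>') kolmogorov c"
proof (rule ladder.intro)
  show "local_linear (sym_op a b \<alpha> \<beta>)" "local_linear (sym_op a' b' \<alpha>' \<beta>')"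
    by (rule symmetry.local_linear_sym_op, rule assms)+
next
  fix S f and p :: pt assume S: "open S" "smooth_on S f" "p \<in> S"
  show "sym_op a b \<alpha> \<beta> (sym_op a' b' \<alpha>' \<beta>' f) p = sym_op a' b' \<alpha>' \<beta>' (sym_op a b \<alpha> \<beta> f) p + c * f p"
    by (rule sym_op_commutator[OF assms(1,2) S assms(4)])
  show "kolmogorov (sym_op a b \<alpha> \<beta> f) p = sym_op a b \<alpha> \<beta> (kolmogorov f) p"
    by (rule symmetry.kolmogorov_commute[OF assms(1) S])
  show "kolmogorov (sym_op a' b' \<alpha>' \<beta>' f) p = sym_op a' b' \<alpha>' \<beta>' (kolmogorov f) p"
    by (rule symmetry.kolmogorov_commute[OF assms(2) S])
qed (rule local_linear_kolmogorov, rule assms)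

subsection \<open>Solutions of the heat equation in reparametrized time\<close>

text \<open>For a function whose derivative is as regular as the function itself, as for a solution
  of a differential equation with smooth right-hand side.\<close>

lemma smooth_on_bootstrap:
  assumes "open S" "\<And>p. p \<in> S \<Longrightarrow> (f has_derivative F p) (at p)"
    and "\<And>k v. Ck_on k S f \<Longrightarrow> Ck_on k S (\<lambda>p. F p v)"
  shows "smooth_on S f"
  unfolding smooth_on_def
proof
  fix k show "Ck_on k S f"
  proof (induction k)
    case 0
    show ?case
      using has_derivative_continuous[OF assms(2)] by (simp add: continuous_at_imp_continuous_on)
  next
    case (Suc k)
    show ?case by (rule Ck_on_SucI[OF assms(1,2) assms(3)[OF Suc]])
  qed
qed

lemma smooth_on_compose_pair:
  fixes \<theta> :: "real \<times> real \<Rightarrow> real"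
  assumes "open S" "open V" "\<And>p. p \<in> S \<Longrightarrow> (z1 p, z2 p) \<in> V"
    and "smooth_on V \<theta>" "smooth_on S z1" "smooth_on S z2"
  shows "smooth_on S (\<lambda>p. \<theta> (z1 p, z2 p))"
  unfolding smooth_on_def
proof
  fix k show "Ck_on k S (\<lambda>p. \<theta> (z1 p, z2 p))"
    by (rule Ck_on_compose_pair[OF assms(1,2)]) (rule assms(3) smooth_onD assms(4-6) | assumption)+
qed

lemma dir_deriv_triple:
  assumes "smooth_on S f" "p \<in> S"
  shows "dir_deriv v f p = fst v * Dt f p + fst (snd v) * Dx f p + snd (snd v) * Dy f p"
proof -
  interpret bounded_linear "\<lambda>v. dir_deriv v f p"
    by (rule has_derivative_bounded_linear[OF smooth_on_has_derivative[OF assms]])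
  have "v = fst v *\<^sub>R (1, 0, 0) + fst (snd v) *\<^sub>R (0, 1, 0) + snd (snd v) *\<^sub>R (0, 0, 1)"
    by (cases v) auto
  then have "dir_deriv v f p
    = dir_deriv (fst v *\<^sub>R (1, 0, 0) + fst (snd v) *\<^sub>R (0, 1, 0) + snd (snd v) *\<^sub>R (0, 0, 1)) f p"
    by simp
  also have "\<dots> = fst v * Dt f p + fst (snd v) * Dx f p + snd (snd v) * Dy f p"
    by (simp only: add scaleR real_scaleR_def)
  finally show ?thesis .
qed

text \<open>A mean value inequality relative to h instead of t. Since the derivatives of h and
  \<phi> share the factor k^2, both (c + e) h - \<phi> and \<phi> - (c - e) h are nondecreasing,
  even where k vanishes and a quotient of derivatives would make no sense.\<close>

lemma has_derivative_square_bound: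
  fixes h \<phi> \<psi> k :: "real \<Rightarrow> real"
  assumes "a \<le> b"
    and "\<And>t. a \<le> t \<Longrightarrow> t \<le> b \<Longrightarrow> (h has_real_derivative (k t)\<^sup>2) (at t)"
    and "\<And>t. a \<le> t \<Longrightarrow> t \<le> b \<Longrightarrow> (\<phi> has_real_derivative (k t)\<^sup>2 * \<psi> t) (at t)"
    and "\<And>t. a \<le> t \<Longrightarrow> t \<le> b \<Longrightarrow> \<bar>\<psi> t - c\<bar> \<le> e"
  shows "\<bar>\<phi> b - \<phi> a - c * (h b - h a)\<bar> \<le> e * (h b - h a)"
proof -
  have "(c + e) * h a - \<phi> a \<le> (c + e) * h b - \<phi> b"
  proof (rule DERIV_nonneg_imp_nondecreasing[OF assms(1)])
    fix t assume t: "a \<le> t" "t \<le> b"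
    have "((\<lambda>t. (c + e) * h t - \<phi> t) has_real_derivative (c + e) * (k t)\<^sup>2 - (k t)\<^sup>2 * \<psi> t) (at t)"
      by (intro DERIV_diff DERIV_cmult assms(2,3) t)
    moreover have "(c + e) * (k t)\<^sup>2 - (k t)\<^sup>2 * \<psi> t = (k t)\<^sup>2 * (c + e - \<psi> t)"
      by (simp add: algebra_simps)
    moreover have "(k t)\<^sup>2 * (c + e - \<psi> t) \<ge> 0" using assms(4)[OF t] by simp
    ultimately show "\<exists>y. ((\<lambda>t. (c + e) * h t - \<phi> t) has_real_derivative y) (at t) \<and> 0 \<le> y"
      by metis
  qed
  moreover have "\<phi> a - (c - e) * h a \<le> \<phi> b - (c - e) * h b"
  proof (rule DERIV_nonneg_imp_nondecreasing[OF assms(1)])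
    fix t assume t: "a \<le> t" "t \<le> b"
    have "((\<lambda>t. \<phi> t - (c - e) * h t) has_real_derivative (k t)\<^sup>2 * \<psi> t - (c - e) * (k t)\<^sup>2) (at t)"
      by (intro DERIV_diff DERIV_cmult assms(2,3) t)
    moreover have "(k t)\<^sup>2 * \<psi> t - (c - e) * (k t)\<^sup>2 = (k t)\<^sup>2 * (\<psi> t - (c - e))"
      by (simp add: algebra_simps)
    moreover have "(k t)\<^sup>2 * (\<psi> t - (c - e)) \<ge> 0" using assms(4)[OF t] by simp
    ultimately show "\<exists>y. ((\<lambda>t. \<phi> t - (c - e) * h t) has_real_derivative y) (at t) \<and> 0 \<le> y"
      by metis
  qed
  ultimately show ?thesis by (simp add: abs_le_iff algebra_simps)
qed

text \<open>The inverse \<open>\<tau>\<close> of \<open>h\<close> need not be differentiable where \<open>k\<close> vanishes; the factor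
  \<open>k\<^sup>2\<close> common to both derivatives still makes \<open>\<phi> \<circ> \<tau>\<close> differentiable there.\<close>

lemma has_real_derivative_reparametrized:
  fixes h \<phi> \<psi> k \<tau> :: "real \<Rightarrow> real"
  assumes I: "open I" "convex I" "open (h ` I)"
    and h: "\<And>t. t \<in> I \<Longrightarrow> (h has_real_derivative (k t)\<^sup>2) (at t)"
    and \<phi>: "\<And>t. t \<in> I \<Longrightarrow> (\<phi> has_real_derivative (k t)\<^sup>2 * \<psi> t) (at t)"
    and \<psi>: "continuous_on I \<psi>"
    and \<tau>: "\<And>t. t \<in> I \<Longrightarrow> \<tau> (h t) = t" "continuous_on (h ` I) \<tau>"
    and s: "s \<in> h ` I"
  shows "((\<lambda>s. \<phi> (\<tau> s)) has_real_derivative \<psi> (\<tau> s)) (at s)"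
  unfolding has_field_derivative_def has_derivative_within_alt
proof (intro conjI allI impI)
  show "bounded_linear ((*) (\<psi> (\<tau> s)))" by (rule bounded_linear_mult_right)
  fix e :: real assume e: "e > 0"
  obtain t where t: "t \<in> I" "s = h t" using s by blast
  have "isCont \<psi> t" using \<psi> I(1) t(1) by (simp add: continuous_on_eq_continuous_at)
  then obtain d1 where d1: "d1 > 0" "\<And>r. dist r t < d1 \<Longrightarrow> dist (\<psi> r) (\<psi> t) < e"
    using e unfolding continuous_at_eps_delta by (metis dist_commute)
  have "isCont \<tau> s" using \<tau>(2) I(3) s continuous_on_eq_continuous_at by blast
  then obtain d2 where d2: "d2 > 0" "\<And>r. dist r s < d2 \<Longrightarrow> dist (\<tau> r) (\<tau> s) < d1"
    using d1(1) unfolding continuous_at_eps_delta by (metis dist_commute)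
  obtain d3 where d3: "d3 > 0" "ball s d3 \<subseteq> h ` I" using I(3) s open_contains_ball by blast
  have "norm (\<phi> (\<tau> r) - \<phi> (\<tau> s) - \<psi> (\<tau> s) * (r - s)) \<le> e * norm (r - s)"
    if r: "norm (r - s) < min d2 d3" for r
  proof -
    have "dist s r < d3" using r by (simp add: dist_real_def abs_minus_commute)
    then have "r \<in> h ` I" using d3 by auto
    then obtain t' where t': "t' \<in> I" "r = h t'" by blast
    have "dist (\<tau> r) (\<tau> s) < d1" by (rule d2(2)) (use r in \<open>simp add: dist_norm\<close>)
    then have near: "\<bar>t' - t\<bar> < d1" by (simp add: t t' \<tau>(1) dist_real_def)
    have seg: "q \<in> I" if "min t t' \<le> q" "q \<le> max t t'" for q
      using I(2) t(1) t'(1) that by (metis mem_is_interval_1_I is_interval_convex_1 max_def min_def)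
    have bd: "\<bar>\<psi> q - \<psi> t\<bar> \<le> e" if "min t t' \<le> q" "q \<le> max t t'" for q
    proof -
      have "\<bar>q - t\<bar> < d1" using near that by (auto simp: min_def max_def split: if_splits)
      then show ?thesis using d1(2)[of q] by (simp add: dist_real_def)
    qed
    show ?thesis
    proof (cases "t \<le> t'")
      case True
      have "\<bar>\<phi> t' - \<phi> t - \<psi> t * (h t' - h t)\<bar> \<le> e * (h t' - h t)"
        by (rule has_derivative_square_bound[OF True h \<phi> bd]) (use True seg in auto)
      then show ?thesis unfolding t(2) t'(2) \<tau>(1)[OF t(1)] \<tau>(1)[OF t'(1)] real_norm_def
        using mult_left_mono[of "h t' - h t" "\<bar>h t' - h t\<bar>" e] e by linarith
    next
      case False
      then have "t' \<le> t" by simp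
      have "\<bar>\<phi> t - \<phi> t' - \<psi> t * (h t - h t')\<bar> \<le> e * (h t - h t')"
        by (rule has_derivative_square_bound[OF \<open>t' \<le> t\<close> h \<phi> bd]) (use False seg in auto)
      moreover have "\<phi> t' - \<phi> t - \<psi> t * (h t' - h t) = - (\<phi> t - \<phi> t' - \<psi> t * (h t - h t'))"
        by (simp add: algebra_simps)
      ultimately show ?thesis unfolding t(2) t'(2) \<tau>(1)[OF t(1)] \<tau>(1)[OF t'(1)] real_norm_def
        using mult_left_mono[of "h t - h t'" "\<bar>h t' - h t\<bar>" e] e by linarith
    qed
  qed
  then show "\<exists>d>0. \<forall>r\<in>UNIV. norm (r - s) < d \<longrightarrow>
      norm (\<phi> (\<tau> r) - \<phi> (\<tau> s) - \<psi> (\<tau> s) * (r - s)) \<le> e * norm (r - s)"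
    using d2(1) d3(1) by (intro exI[of _ "min d2 d3"]) auto
qed

text \<open>The system is closed: partial derivatives of members are members. Differentiability
  makes all of them continuous, and each order of smoothness then passes from all members to all
  members. The heat equation holds because \<Theta>_2 is both the first z1-derivative and the second
  z2-derivative of \<Theta>_0.\<close>

lemma heat_solution_of_sequence:
  fixes \<Theta> :: "nat \<Rightarrow> real \<times> real \<Rightarrow> real"
  assumes "open V"
    and d: "\<And>j q. q \<in> V \<Longrightarrow> (\<Theta> j has_derivative (\<lambda>(r, s). r * \<Theta> (Suc (Suc j)) q + s * \<Theta> (Suc j) q)) (at q)"
  shows "heat_solution V (\<Theta> 0)"
proof -
  have "Ck_on k V (\<Theta> j)" for k j
  proof (induction k arbitrary: j)
    case 0
    show ?case
      using has_derivative_continuous[OF d] by (simp add: continuous_at_imp_continuous_on)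
  next
    case (Suc k)
    show ?case
    proof (rule Ck_on_SucI[OF assms(1) d])
      fix v :: "real \<times> real"
      have "Ck_on k V (\<lambda>q. fst v * \<Theta> (Suc (Suc j)) q + snd v * \<Theta> (Suc j) q)"
        by (intro Ck_on_add Ck_on_mult Ck_on_const Suc assms(1))
      then show "Ck_on k V (\<lambda>q. case v of (r, s) \<Rightarrow> r * \<Theta> (Suc (Suc j)) q + s * \<Theta> (Suc j) q)"
        by (simp add: case_prod_beta)
    qed
  qed
  moreover have z: "dir_deriv (0, 1) (\<Theta> j) q = \<Theta> (Suc j) q" if "q \<in> V" for q j
    using dir_deriv_eq[OF d[OF that], of "(0,1)" j] by simp
  moreover have "dir_deriv (1, 0) (\<Theta> 0) q = dir_deriv (0, 1) (dir_deriv (0, 1) (\<Theta> 0)) q"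
    if q: "q \<in> V" for q
  proof -
    have "dir_deriv (1, 0) (\<Theta> 0) q = \<Theta> (Suc (Suc 0)) q"
      using dir_deriv_eq[OF d[OF q], of "(1,0)" 0] by simp
    also have "\<dots> = dir_deriv (0, 1) (\<Theta> (Suc 0)) q" using z[OF q] by simp
    also have "\<dots> = dir_deriv (0, 1) (dir_deriv (0, 1) (\<Theta> 0)) q"
      by (rule dir_deriv_cong[OF assms(1) q z[symmetric]])
    finally show ?thesis .
  qed
  ultimately show ?thesis
    using assms(1) by (simp add: heat_solution_def smooth_on_def)
qed

text \<open>Joint continuity is demanded of the second partial derivative only. The first, obtained
  by reparametrization for one fixed value of the second variable, need only exist at the
  point.\<close>

lemma has_derivative_pair_of_partials:
  fixes f fs fz :: "real \<Rightarrow> real \<Rightarrow> real"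
  assumes "open X" "open Y" "convex Y" "s \<in> X" "y \<in> Y"
    and s: "((\<lambda>s. f s y) has_real_derivative fs s y) (at s)"
    and z: "\<And>s y. s \<in> X \<Longrightarrow> y \<in> Y \<Longrightarrow> (f s has_real_derivative fz s y) (at y)"
    and c: "continuous_on (X \<times> Y) (\<lambda>(s, y). fz s y)"
  shows "((\<lambda>(s, y). f s y) has_derivative (\<lambda>(r, u). r * fs s y + u * fz s y)) (at (s, y))"
proof -
  have "((\<lambda>(s, y). f s y) has_derivative
      (\<lambda>(r, u). fs s y * r + blinfun_apply (blinfun_mult_right (fz s y)) u)) (at (s, y) within X \<times> Y)"
  proof (rule has_derivative_partialsI)
    show "((\<lambda>s. f s y) has_derivative (*) (fs s y)) (at s within X)"
      using s unfolding has_field_derivative_def by (rule has_derivative_at_withinI)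
    show "(f s' has_derivative blinfun_apply (blinfun_mult_right (fz s' y'))) (at y' within Y)"
      if "s' \<in> X" "y' \<in> Y" for s' y'
      using z[OF that] unfolding has_field_derivative_def blinfun_mult_right.rep_eq
      by (rule has_derivative_at_withinI)
    have "continuous_on (X \<times> Y) (\<lambda>p. blinfun_mult_right (case p of (s, y) \<Rightarrow> fz s y))"
      using bounded_linear.continuous_on[OF bounded_linear_blinfun_mult_right c] .
    then show "continuous (at (s, y) within X \<times> Y) (\<lambda>(s, y). blinfun_mult_right (fz s y))"
      using assms(4,5) unfolding continuous_on_eq_continuous_within case_prod_unfold by force
  qed (use assms in auto)
  then have "((\<lambda>(s, y). f s y) has_derivative
      (\<lambda>(r, u). fs s y * r + blinfun_apply (blinfun_mult_right (fz s y)) u)) (at (s, y))"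
    using at_within_open[of "(s, y)" "X \<times> Y"] assms by (simp add: open_Times)
  then show ?thesis by (simp add: blinfun_mult_right.rep_eq mult.commute)
qed

subsection \<open>Reduction to the heat equation\<close>

text \<open>With \<open>\<gamma> = (ln w)\<^sub>x / x\<close>, the hypotheses say that \<open>w\<close> is a solution not depending on \<open>y\<close>
  and annihilated by the operator, and that substituting \<open>w \<theta>(h(t), k(t) x + m y)\<close> turns the
  equation into \<open>\<theta>\<^sub>1 = \<theta>\<^sub>2\<^sub>2\<close>. The \<open>(x, y)\<close>-part of the operator is \<open>lam\<close> times
  \<open>(m, -k)\<close>, tangent to the level sets of \<open>k x + m y\<close>, and the constant vector \<open>(c1, c2)\<close>
  is transversal to them. The function \<open>k\<close> may vanish at isolated times.\<close>

locale heat_reduction = symmetry a b \<alpha> 0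
  for a b \<alpha> :: "real \<Rightarrow> real" +
  fixes \<gamma> k h lam :: "real \<Rightarrow> real" and m c1 c2 :: real and T :: "real set" and w :: "pt \<Rightarrow> real"
  assumes T: "open T"
    and w_nz: "fst p \<in> T \<Longrightarrow> w p \<noteq> 0"
    and w: "fst p \<in> T \<Longrightarrow> (w has_derivative (\<lambda>v. w p *
        (fst v * (\<gamma> (fst p) + (fst (snd p))\<^sup>2 * (\<gamma> (fst p))\<^sup>2) + fst (snd v) * (fst (snd p) * \<gamma> (fst p))))) (at p)"
    and \<gamma>: "t \<in> T \<Longrightarrow> (\<gamma> has_real_derivative 2 * (\<gamma> t)\<^sup>2) (at t)"
    and k: "t \<in> T \<Longrightarrow> (k has_real_derivative 2 * \<gamma> t * k t - m) (at t)"
    and h: "t \<in> T \<Longrightarrow> (h has_real_derivative (k t)\<^sup>2) (at t)"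
    and \<alpha>_eq: "t \<in> T \<Longrightarrow> \<alpha> t = - a t * \<gamma> t"
    and lam: "t \<in> T \<Longrightarrow> lam t \<noteq> 0" "t \<in> T \<Longrightarrow> a t = lam t * m" "t \<in> T \<Longrightarrow> b t = - lam t * k t"
    and transversal: "t \<in> T \<Longrightarrow> k t * c1 + m * c2 = 1"
begin

abbreviation "A \<equiv> sym_op a b \<alpha> 0"

definition z2 :: "pt \<Rightarrow> real" where
  "z2 p = k (fst p) * fst (snd p) + m * snd (snd p)"

definition z :: "pt \<Rightarrow> real \<times> real" where
  "z p = (h (fst p), z2 p)"

definition dz1 :: "pt \<Rightarrow> pt \<Rightarrow> real" where
  "dz1 p v = fst v * (k (fst p))\<^sup>2"

definition dz2 :: "pt \<Rightarrow> pt \<Rightarrow> real" where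
  "dz2 p v = fst v * ((2 * \<gamma> (fst p) * k (fst p) - m) * fst (snd p)) + fst (snd v) * k (fst p) + snd (snd v) * m"

abbreviation dom :: "pt set" where "dom \<equiv> {p. fst p \<in> T}"

context
  fixes S :: "pt set"
  assumes S: "open S" "S \<subseteq> dom"
begin

text \<open>The locale provides only first derivatives. Smoothness of \<gamma>, then k, then w, is
  bootstrapped from their differential equations; the order matters, since \<gamma> occurs in the
  other two.\<close>

lemma smooth_on_gamma: "smooth_on S (\<lambda>p. \<gamma> (fst p))"
proof (rule smooth_on_bootstrap[OF S(1)])
  show "((\<lambda>p. \<gamma> (fst p)) has_derivative (\<lambda>v. fst v * (2 * (\<gamma> (fst p))\<^sup>2))) (at p)" if "p \<in> S" for p
    using S(2) that by (intro has_derivative_time \<gamma>) auto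
  show "Ck_on j S (\<lambda>p. fst v * (2 * (\<gamma> (fst p))\<^sup>2))" if "Ck_on j S (\<lambda>p. \<gamma> (fst p))" for j v
    unfolding power2_eq_square by (intro Ck_on_mult Ck_on_const that S(1))
qed

lemma smooth_on_k: "smooth_on S (\<lambda>p. k (fst p))"
proof (rule smooth_on_bootstrap[OF S(1)])
  show "((\<lambda>p. k (fst p)) has_derivative (\<lambda>v. fst v * (2 * \<gamma> (fst p) * k (fst p) + - m))) (at p)"
    if "p \<in> S" for p
    using S(2) that k[of "fst p"] by (intro has_derivative_time) auto
  show "Ck_on j S (\<lambda>p. fst v * (2 * \<gamma> (fst p) * k (fst p) + - m))" if "Ck_on j S (\<lambda>p. k (fst p))" for j v
    by (intro Ck_on_mult Ck_on_add Ck_on_const that S(1) smooth_onD[OF smooth_on_gamma])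
qed

lemma smooth_on_h: "smooth_on S (\<lambda>p. h (fst p))"
  using S(2) smooth_on_mult[OF S(1) smooth_on_k smooth_on_k]
  by (intro smooth_on_time[OF S(1) h]) (auto simp: power2_eq_square)

lemma smooth_on_z2: "smooth_on S z2"
  unfolding z2_def[abs_def]
  by (intro smooth_on_add smooth_on_mult smooth_on_cmult smooth_on_k smooth_on_fst_snd smooth_on_snd_snd S(1))

lemma smooth_on_log_weight:
  "smooth_on S (\<lambda>p. fst v * (\<gamma> (fst p) + (fst (snd p))\<^sup>2 * (\<gamma> (fst p))\<^sup>2) + fst (snd v) * (fst (snd p) * \<gamma> (fst p)))"
  unfolding power2_eq_square
  by (intro smooth_on_add smooth_on_mult smooth_on_const smooth_on_gamma smooth_on_fst_snd S(1))

lemma smooth_on_weight: "smooth_on S w"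
  by (rule smooth_on_bootstrap[OF S(1) w])
     (use S(2) in \<open>auto intro: Ck_on_mult[OF S(1) _ smooth_onD[OF smooth_on_log_weight]]\<close>)

lemma smooth_on_inverse_weight: "smooth_on S (\<lambda>p. inverse (w p))"
proof (rule smooth_on_bootstrap[OF S(1)])
  fix p assume "p \<in> S"
  then have p: "fst p \<in> T" using S(2) by auto
  have aux: "- (inverse r * (r * l) * inverse r) = inverse r * (- l)" if "r \<noteq> 0" for r l :: real
    using that by (simp add: field_simps)
  show "((\<lambda>p. inverse (w p)) has_derivative (\<lambda>v. inverse (w p) * (- (fst v * (\<gamma> (fst p) + (fst (snd p))\<^sup>2 * (\<gamma> (fst p))\<^sup>2)
      + fst (snd v) * (fst (snd p) * \<gamma> (fst p)))))) (at p)"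
    by (rule has_derivative_eq_rhs[OF Deriv.has_derivative_inverse[OF w_nz[OF p] w[OF p]]])
       (rule ext, rule aux[OF w_nz[OF p]])
next
  fix j v assume "Ck_on j S (\<lambda>p. inverse (w p))"
  then show "Ck_on j S (\<lambda>p. inverse (w p) * (- (fst v * (\<gamma> (fst p) + (fst (snd p))\<^sup>2 * (\<gamma> (fst p))\<^sup>2)
      + fst (snd v) * (fst (snd p) * \<gamma> (fst p)))))"
    by (intro Ck_on_mult S(1) smooth_onD[OF smooth_on_minus] smooth_on_log_weight)
qed

end

lemma has_derivative_z1:
  assumes "fst p \<in> T"
  shows "((\<lambda>p. h (fst p)) has_derivative dz1 p) (at p)"
  using has_derivative_time[OF h[OF assms]] by (simp add: dz1_def[abs_def])

lemma has_derivative_z2: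
  assumes "fst p \<in> T"
  shows "(z2 has_derivative dz2 p) (at p)"
proof -
  have "(z2 has_derivative (\<lambda>v. (k (fst p) * fst (snd v) + (fst v * (2 * \<gamma> (fst p) * k (fst p) - m)) * fst (snd p))
      + m * snd (snd v))) (at p)"
    unfolding z2_def[abs_def]
    by (intro has_derivative_add has_derivative_mult has_derivative_mult_right has_derivative_time
        k assms has_derivative_fst has_derivative_snd has_derivative_ident)
  then show ?thesis
    by (rule has_derivative_eq_rhs) (simp add: dz2_def fun_eq_iff algebra_simps)
qed

lemma has_derivative_compose_z:
  assumes "smooth_on V \<theta>" "z p \<in> V" "fst p \<in> T"
  shows "((\<lambda>r. \<theta> (z r)) has_derivative
    (\<lambda>v. dz1 p v * dir_deriv (1, 0) \<theta> (z p) + dz2 p v * dir_deriv (0, 1) \<theta> (z p))) (at p)"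
proof -
  have "(z has_derivative (\<lambda>v. (dz1 p v, dz2 p v))) (at p)"
    unfolding z_def[abs_def]
    by (intro has_derivative_Pair has_derivative_z1 has_derivative_z2 assms)
  from has_derivative_compose[OF this smooth_on_has_derivative[OF assms(1,2)]]
  show ?thesis
    by (rule has_derivative_eq_rhs) (rule ext, rule dir_deriv_pair[OF differentiableI[OF smooth_on_has_derivative[OF assms(1,2)]]])
qed

text \<open>On substitution the terms with \<theta> cancel because w is a solution, those with
  \<theta>_2 by the equation for k, and what remains of the equation is w k^2 (\<theta>_1 -
  \<theta>_22). The operator kills the product since \<alpha> = - a \<gamma> and a k + b m =
  0.\<close>

lemma heat_solution_lifts:
  assumes U: "open U" "U \<subseteq> dom" "z ` U \<subseteq> V" and heat: "heat_solution V \<theta>"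
  shows "smooth_on U (\<lambda>r. w r * \<theta> (z r)) \<and>
    (\<forall>q\<in>U. A (\<lambda>r. w r * \<theta> (z r)) q = 0 \<and> kolmogorov (\<lambda>r. w r * \<theta> (z r)) q = 0)"
proof (intro conjI ballI)
  have V: "open V" "smooth_on V \<theta>" using heat by (auto simp: heat_solution_def)
  let ?W = "\<lambda>r. w r * \<theta> (z r)"
  show "smooth_on U ?W"
    unfolding z_def
    by (intro smooth_on_mult smooth_on_weight smooth_on_compose_pair[OF U(1) V(1) _ V(2)]
        smooth_on_h smooth_on_z2 U) (use U(3) in \<open>auto simp: z_def\<close>)
  fix q assume q: "q \<in> U"
  define \<theta>1 \<theta>2 where "\<theta>1 = dir_deriv (1, 0) \<theta>" "\<theta>2 = dir_deriv (0, 1) \<theta>"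
  have d: "((\<lambda>r. w r * f (z r)) has_derivative (\<lambda>v. w p * (dz1 p v * dir_deriv (1, 0) f (z p) + dz2 p v * dir_deriv (0, 1) f (z p))
      + (w p * (fst v * (\<gamma> (fst p) + (fst (snd p))\<^sup>2 * (\<gamma> (fst p))\<^sup>2) + fst (snd v) * (fst (snd p) * \<gamma> (fst p)))) * f (z p))) (at p)"
    if "smooth_on V f" "p \<in> U" for f p
    using that U(2,3) by (intro has_derivative_mult w has_derivative_compose_z[of V]) auto
  have t: "Dt ?W p = w p * ((\<gamma> (fst p) + (fst (snd p))\<^sup>2 * (\<gamma> (fst p))\<^sup>2) * \<theta> (z p)
      + (k (fst p))\<^sup>2 * \<theta>1 (z p) + (2 * \<gamma> (fst p) * k (fst p) - m) * fst (snd p) * \<theta>2 (z p))"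
    and x: "Dx ?W p = w p * (fst (snd p) * \<gamma> (fst p) * \<theta> (z p) + k (fst p) * \<theta>2 (z p))"
    and y: "Dy ?W p = w p * (m * \<theta>2 (z p))" if "p \<in> U" for p
    unfolding dir_deriv_eq[OF d[OF V(2) that]]
    by (simp_all add: dz1_def dz2_def \<theta>1_\<theta>2_def algebra_simps)
  let ?t = "fst q" and ?x = "fst (snd q)"
  have tT: "?t \<in> T" using q U(2) by auto
  have "A ?W q = w q * ((a ?t * \<gamma> ?t + \<alpha> ?t) * ?x * \<theta> (z q) + (a ?t * k ?t + b ?t * m) * \<theta>2 (z q))"
    by (simp add: sym_op_def x[OF q] y[OF q] algebra_simps)
  also have "\<dots> = 0" using \<alpha>_eq[OF tT] lam(2,3)[OF tT] by simp
  finally show "A ?W q = 0" .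
  have sm2: "smooth_on V \<theta>2" unfolding \<theta>1_\<theta>2_def by (rule smooth_on_dir_deriv[OF V(2)])
  \<comment> \<open>Written so that only products of w with a function of z get differentiated
    again; the rule \<open>d\<close> then applies to \<theta> and to its derivative
    \<open>\<theta>2\<close>.\<close>
  have "Dx (Dx ?W) q = Dx (\<lambda>p. (fst (snd p) * \<gamma> (fst p)) * (w p * \<theta> (z p)) + k (fst p) * (w p * \<theta>2 (z p))) q"
    using x by (intro dir_deriv_cong[OF U(1) q]) (simp add: algebra_simps)
  also have "\<dots> = w q * (\<gamma> ?t * \<theta> (z q) + ?x * \<gamma> ?t * (?x * \<gamma> ?t * \<theta> (z q) + k ?t * \<theta>2 (z q))
      + k ?t * (?x * \<gamma> ?t * \<theta>2 (z q) + k ?t * dir_deriv (0, 1) \<theta>2 (z q)))"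
  proof -
    have "((\<lambda>p. (fst (snd p) * \<gamma> (fst p)) * (w p * \<theta> (z p)) + k (fst p) * (w p * \<theta>2 (z p))) has_derivative
      (\<lambda>v. ((?x * \<gamma> ?t) * dir_deriv v ?W q + (?x * (fst v * (2 * (\<gamma> ?t)\<^sup>2)) + fst (snd v) * \<gamma> ?t) * (w q * \<theta> (z q)))
        + (k ?t * dir_deriv v (\<lambda>p. w p * \<theta>2 (z p)) q + (fst v * (2 * \<gamma> ?t * k ?t - m)) * (w q * \<theta>2 (z q))))) (at q)"
      by (intro has_derivative_add has_derivative_mult[of "\<lambda>p. fst (snd p) * \<gamma> (fst p)"] has_derivative_mult[of "\<lambda>p. k (fst p)"]
          has_derivative_mult[of "\<lambda>p. fst (snd p)"] has_derivative_time \<gamma> k tT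
          has_derivative_dir_deriv has_derivative_fst has_derivative_snd has_derivative_ident
          differentiableI[OF d[OF V(2) q]] differentiableI[OF d[OF sm2 q]])
    from dir_deriv_eq[OF this, of "(0,1,0)"] show ?thesis
      unfolding dir_deriv_eq[OF d[OF sm2 q]] x[OF q]
      by (simp add: dz1_def dz2_def \<theta>1_\<theta>2_def algebra_simps)
  qed
  finally have xx: "Dx (Dx ?W) q = w q * (\<gamma> ?t * \<theta> (z q) + ?x * \<gamma> ?t * (?x * \<gamma> ?t * \<theta> (z q) + k ?t * \<theta>2 (z q))
      + k ?t * (?x * \<gamma> ?t * \<theta>2 (z q) + k ?t * dir_deriv (0, 1) \<theta>2 (z q)))" .
  have "\<theta>1 (z q) = dir_deriv (0, 1) \<theta>2 (z q)"
    using heat q U(3) by (auto simp: heat_solution_def \<theta>1_\<theta>2_def)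
  then show "kolmogorov ?W q = 0"
    unfolding kolmogorov_def xx t[OF q] y[OF q] by (simp add: power2_eq_square algebra_simps)
qed

end

section \<open>Functions that factor through z\<close>

context heat_reduction
begin

definition e :: pt where "e = (0, c1, c2)"

text \<open>A section of (t, z2): in the time slice t, start at the (x, y) of p and move along (c1,
  c2). By transversality z2 grows at unit rate there, so the required displacement is \<zeta> minus
  the value of z2 at the start.\<close>

definition section_at :: "pt \<Rightarrow> real \<Rightarrow> real \<Rightarrow> pt" where
  "section_at p t \<zeta> = (t,
     fst (snd p) + c1 * (\<zeta> - (k t * fst (snd p) + m * snd (snd p))),
     snd (snd p) + c2 * (\<zeta> - (k t * fst (snd p) + m * snd (snd p))))"

lemma z2_section_at: "t \<in> T \<Longrightarrow> z2 (section_at p t \<zeta>) = \<zeta>"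
proof -
  assume "t \<in> T"
  have "z2 (section_at p t \<zeta>) = (k t * fst (snd p) + m * snd (snd p))
    + (k t * c1 + m * c2) * (\<zeta> - (k t * fst (snd p) + m * snd (snd p)))"
    by (simp add: z2_def section_at_def algebra_simps)
  then show ?thesis using transversal[OF \<open>t \<in> T\<close>] by simp
qed

lemma section_at_z2: "section_at p (fst p) (z2 p) = p"
  by (simp add: section_at_def z2_def)

text \<open>Differentiating the transversality relation in t gives c1 k' = 0. This is the price of a
  constant transversal vector: it points along y unless k is stationary.\<close>

lemma c1_deriv_k:
  assumes "t \<in> T"
  shows "c1 * (2 * \<gamma> t * k t - m) = 0"
proof -
  have "((\<lambda>t. k t * c1 + m * c2) has_real_derivative (2 * \<gamma> t * k t - m) * c1 + 0) (at t)"
    by (intro DERIV_add DERIV_cmult_right k assms DERIV_const)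
  moreover have "((\<lambda>t. k t * c1 + m * c2) has_real_derivative 0) (at t)"
    by (rule has_field_derivative_transform_within_open[OF DERIV_const T assms])
       (simp add: transversal)
  ultimately show ?thesis using DERIV_unique by fastforce
qed

text \<open>As h is nondecreasing, equal values at two times make it constant between them. Then k =
  0 on an interval, hence k' = 0 there, the equation for k gives m = 0, and transversality
  fails.\<close>

lemma inj_on_h:
  assumes "I \<subseteq> T" "convex I"
  shows "inj_on h I"
proof -
  have ne: "h s \<noteq> h t" if st: "s \<in> I" "t \<in> I" "s < t" for s t
  proof
    assume eq: "h s = h t"
    have sub: "q \<in> T" if "s \<le> q" "q \<le> t" for q
      using assms that st by (meson in_mono mem_is_interval_1_I is_interval_convex_1)
    have mono: "h p \<le> h q" if "s \<le> p" "p \<le> q" "q \<le> t" for p q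
      by (rule DERIV_nonneg_imp_nondecreasing[OF that(2)])
         (use h sub that in \<open>meson order_trans zero_le_power2\<close>)
    have hs: "h q = h s" if "q \<in> {s<..<t}" for q
      using mono[of s q] mono[of q t] that eq by auto
    have k0: "k q = 0" if q: "q \<in> {s<..<t}" for q
    proof -
      have "(h has_real_derivative 0) (at q)"
        by (rule has_field_derivative_transform_within_open[OF DERIV_const open_greaterThanLessThan q])
           (simp add: hs)
      moreover have "q \<in> T" using q by (intro sub) auto
      ultimately have "(k q)\<^sup>2 = 0" using DERIV_unique h by blast
      then show ?thesis by simp
    qed
    define q where "q = (s + t) / 2"
    have q: "q \<in> {s<..<t}" "q \<in> T" using st(3) sub by (auto simp: q_def)
    have "(k has_real_derivative 0) (at q)"
      by (rule has_field_derivative_transform_within_open[OF DERIV_const open_greaterThanLessThan q(1)])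
         (simp add: k0)
    then have "2 * \<gamma> q * k q - m = 0" using DERIV_unique[OF k[OF q(2)]] by blast
    then show False using k0[OF q(1)] transversal[OF q(2)] by simp
  qed
  then show ?thesis by (metis inj_onI linorder_neqE_linordered_idom)
qed

text \<open>The hypothesis reads \<open>dG\<^sub>j = G\<^sub>j\<^sub>+\<^sub>2 dz\<^sub>1 + G\<^sub>j\<^sub>+\<^sub>1 dz\<^sub>2\<close>.\<close>

lemma factor_through_z:
  fixes G :: "nat \<Rightarrow> pt \<Rightarrow> real"
  assumes \<Omega>: "open \<Omega>" "\<Omega> \<subseteq> dom" "p \<in> \<Omega>"
    and G: "\<And>j q. q \<in> \<Omega> \<Longrightarrow> (G j has_derivative (\<lambda>v. dz1 q v * G (Suc (Suc j)) q + dz2 q v * G (Suc j) q)) (at q)"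
  shows "\<exists>U V \<theta>. open U \<and> p \<in> U \<and> U \<subseteq> \<Omega> \<and> z ` U \<subseteq> V \<and> heat_solution V \<theta> \<and> (\<forall>q\<in>U. G 0 q = \<theta> (z q))"
proof -
  define x0 y0 where "x0 = fst (snd p)" "y0 = snd (snd p)"
  define \<sigma> where "\<sigma> = section_at p"
  obtain r where r: "r > 0" "ball p r \<subseteq> \<Omega>" using \<Omega> open_contains_ball by blast
  have contk: "continuous_on T k" using k by (meson DERIV_isCont continuous_at_imp_continuous_on)
  have conth: "continuous_on T h" using h by (meson DERIV_isCont continuous_at_imp_continuous_on)
  have cont\<sigma>: "continuous_on (T \<times> UNIV) (\<lambda>(t, \<zeta>). \<sigma> t \<zeta>)"
    unfolding \<sigma>_def section_at_def case_prod_beta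
    by (intro continuous_intros continuous_on_compose2[OF contk]) auto
  have "open ((\<lambda>(t, \<zeta>). \<sigma> t \<zeta>) -` ball p r \<inter> (T \<times> UNIV))"
    using continuous_open_vimage[of "ball p r"] cont\<sigma> T
    by (simp add: continuous_on_open_vimage open_Times)
  moreover have "(fst p, z2 p) \<in> (\<lambda>(t, \<zeta>). \<sigma> t \<zeta>) -` ball p r \<inter> (T \<times> UNIV)"
    using r(1) \<Omega>(2,3) by (auto simp: \<sigma>_def section_at_z2)
  ultimately obtain I0 J0 where IJ: "open I0" "open J0" "(fst p, z2 p) \<in> I0 \<times> J0"
    "I0 \<times> J0 \<subseteq> (\<lambda>(t, \<zeta>). \<sigma> t \<zeta>) -` ball p r \<inter> (T \<times> UNIV)"
    by (rule open_prod_elim)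
  then have IJ0: "fst p \<in> I0" "z2 p \<in> J0" by simp_all
  obtain d1 d2 where d: "d1 > 0" "ball (fst p) d1 \<subseteq> I0" "d2 > 0" "ball (z2 p) d2 \<subseteq> J0"
    using IJ(1,2) IJ0 open_contains_ball by metis
  \<comment> \<open>Balls, for convexity: of I for the inverse of h and the reparametrization, of J
    for joining the partial derivatives.\<close>
  define I where "I = ball (fst p) d1"
  define J where "J = ball (z2 p) d2"
  have I: "open I" "convex I" and J: "open J" "convex J" by (simp_all add: I_def J_def)
  have IJ': "t \<in> T \<and> \<sigma> t \<zeta> \<in> ball p r" if "t \<in> I" "\<zeta> \<in> J" for t \<zeta>
  proof -
    have "(t, \<zeta>) \<in> I0 \<times> J0" using that d(2,4) unfolding I_def J_def by blast
    from subsetD[OF IJ(4) this] show ?thesis by simp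
  qed
  have "z2 p \<in> J" using d(3) by (simp add: J_def)
  then have IT: "I \<subseteq> T" using IJ' by blast
  have \<sigma>B: "\<sigma> t \<zeta> \<in> ball p r" if "t \<in> I" "\<zeta> \<in> J" for t \<zeta>
    using IJ'[OF that] by (rule conjunct2)
  have \<sigma>\<Omega>: "\<sigma> t \<zeta> \<in> \<Omega>" if "t \<in> I" "\<zeta> \<in> J" for t \<zeta> using \<sigma>B[OF that] r by blast
  define U where "U = {q \<in> ball p r. fst q \<in> I \<and> z2 q \<in> J}"
  have contz: "continuous_on (ball p r) z2"
    using has_derivative_continuous[OF has_derivative_z2] r(2) \<Omega>(2)
    by (intro continuous_at_imp_continuous_on) blast
  have "open (ball p r \<inter> (\<lambda>q. (fst q, z2 q)) -` (I \<times> J))"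
    by (intro continuous_open_preimage open_Times I J continuous_intros contz) simp
  moreover have "ball p r \<inter> (\<lambda>q. (fst q, z2 q)) -` (I \<times> J) = U" by (auto simp: U_def)
  ultimately have openU: "open U" by simp
  have pU: "p \<in> U" using r(1) d by (simp add: U_def I_def J_def)
  have U\<Omega>: "U \<subseteq> \<Omega>" using r(2) by (auto simp: U_def)
  define \<phi> where "\<phi> j t \<zeta> = G j (\<sigma> t \<zeta>)" for j t \<zeta>
  have d\<zeta>: "(\<phi> j t has_real_derivative \<phi> (Suc j) t \<zeta>) (at \<zeta>)" if "t \<in> I" "\<zeta> \<in> J" for j t \<zeta>
  proof -
    have "(\<sigma> t has_derivative (\<lambda>u. (0, c1 * u, c2 * u))) (at \<zeta>)"
      unfolding \<sigma>_def section_at_def[abs_def]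
      by (auto intro!: derivative_eq_intros simp: fun_eq_iff)
    from has_derivative_compose[OF this G[OF \<sigma>\<Omega>[OF that]]]
    have "(\<phi> j t has_derivative (\<lambda>u. dz1 (\<sigma> t \<zeta>) (0, c1 * u, c2 * u) * \<phi> (Suc (Suc j)) t \<zeta>
        + dz2 (\<sigma> t \<zeta>) (0, c1 * u, c2 * u) * \<phi> (Suc j) t \<zeta>)) (at \<zeta>)"
      by (simp add: \<phi>_def[abs_def])
    moreover have "dz2 (\<sigma> t \<zeta>) (0, c1 * u, c2 * u) = u" for u
    proof -
      have "dz2 (\<sigma> t \<zeta>) (0, c1 * u, c2 * u) = (k t * c1 + m * c2) * u"
        by (simp add: dz2_def \<sigma>_def section_at_def algebra_simps)
      then show ?thesis using transversal that IT by auto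
    qed
    ultimately show ?thesis
      by (simp add: has_field_derivative_def dz1_def mult_commute_abs)
  qed
  have dt: "((\<lambda>t. \<phi> j t \<zeta>) has_real_derivative (k t)\<^sup>2 * \<phi> (Suc (Suc j)) t \<zeta>) (at t)"
    if "t \<in> I" "\<zeta> \<in> J" for j t \<zeta>
  proof -
    have tT: "t \<in> T" using that IT by blast
    define k' where "k' = 2 * \<gamma> t * k t - m"
    have k': "c1 * k' = 0" using c1_deriv_k[OF tT] by (simp add: k'_def)
    have kd: "(k has_derivative (\<lambda>u. k' * u)) (at t)"
      using k[OF tT] by (simp add: has_field_derivative_def k'_def)
    have "((\<lambda>t. \<sigma> t \<zeta>) has_derivative (\<lambda>u. (u, - (c1 * (k' * u * x0)), - (c2 * (k' * u * x0))))) (at t)"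
      unfolding \<sigma>_def section_at_def[abs_def] x0_y0_def
      by (auto intro!: derivative_eq_intros kd simp: fun_eq_iff)
    from has_derivative_compose[OF this G[OF \<sigma>\<Omega>[OF that]]]
    have "((\<lambda>t. \<phi> j t \<zeta>) has_derivative (\<lambda>u. dz1 (\<sigma> t \<zeta>) (u, - (c1 * (k' * u * x0)), - (c2 * (k' * u * x0))) * \<phi> (Suc (Suc j)) t \<zeta>
        + dz2 (\<sigma> t \<zeta>) (u, - (c1 * (k' * u * x0)), - (c2 * (k' * u * x0))) * \<phi> (Suc j) t \<zeta>)) (at t)"
      by (simp add: \<phi>_def[abs_def])
    \<comment> \<open>With \<zeta> fixed, the section stays on a level set of \<open>z2\<close> as t
      varies, so only the \<open>dz1\<close> term, with its factor k^2, survives.\<close>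
    moreover have "dz2 (\<sigma> t \<zeta>) (u, - (c1 * (k' * u * x0)), - (c2 * (k' * u * x0))) = 0" for u
    proof -
      have "dz2 (\<sigma> t \<zeta>) (u, - (c1 * (k' * u * x0)), - (c2 * (k' * u * x0)))
        = u * (k' * x0) * (1 - (k t * c1 + m * c2)) + u * (c1 * k') * (\<zeta> - (k t * x0 + m * y0))"
        by (simp add: dz2_def \<sigma>_def section_at_def k'_def x0_y0_def algebra_simps)
      then show ?thesis using transversal[OF tT] k' by simp
    qed
    ultimately show ?thesis
      by (simp add: has_field_derivative_def dz1_def mult_commute_abs \<sigma>_def section_at_def mult.assoc mult.commute mult.left_commute)
  qed
  \<comment> \<open>The point q and its representative on the section lie in one convex ball and
    have the same t and \<open>z2\<close>. Both differentials vanish along the segment between them,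
    so \<open>G j\<close> is constant on it.\<close>
  have const: "G j q = \<phi> j (fst q) (z2 q)" if q: "q \<in> U" for j q
  proof -
    define v where "v = \<sigma> (fst q) (z2 q) - q"
    have qI: "fst q \<in> I" "z2 q \<in> J" "q \<in> ball p r" "fst q \<in> T" using q IT by (auto simp: U_def)
    define q' where "q' = \<sigma> (fst q) (z2 q)"
    have "fst q' = fst q" "z2 q' = z2 q"
      using z2_section_at[OF qI(4)] by (simp_all add: q'_def \<sigma>_def) (simp add: section_at_def)
    then have v0: "fst v = 0" and vk: "k (fst q) * fst (snd v) + m * snd (snd v) = 0"
      unfolding v_def q'_def[symmetric] by (simp_all add: z2_def algebra_simps)
    have "((\<lambda>s. G j (q + s *\<^sub>R v)) has_real_derivative 0) (at s)" if s: "0 \<le> s" "s \<le> 1" for s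
    proof -
      have "q + s *\<^sub>R v = (1 - s) *\<^sub>R q + s *\<^sub>R \<sigma> (fst q) (z2 q)" by (simp add: v_def algebra_simps)
      also have "\<dots> \<in> ball p r"
        using \<sigma>B[OF qI(1,2)] qI(3) s convex_ball[of p r] by (intro convexD) auto
      finally have "q + s *\<^sub>R v \<in> \<Omega>" using r(2) by blast
      from has_field_derivative_along[OF G[OF this]]
      moreover have "dz1 (q + s *\<^sub>R v) v = 0" "dz2 (q + s *\<^sub>R v) v = 0"
        using vk by (simp_all add: dz1_def dz2_def v0 mult.commute)
      ultimately show ?thesis by simp
    qed
    from MVT2[OF zero_less_one this] have "G j (q + 1 *\<^sub>R v) = G j (q + 0 *\<^sub>R v)" by auto
    then show ?thesis by (simp add: v_def \<phi>_def)
  qed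
  have inj: "inj_on h I" by (rule inj_on_h[OF IT I(2)])
  have conthI: "continuous_on I h" by (rule continuous_on_subset[OF conth IT])
  \<comment> \<open>Where k vanishes the inverse function theorem gives nothing; continuity and
    injectivity of h are enough here.\<close>
  have openhI: "open (h ` I)" by (rule invariance_of_domain[OF conthI I(1) inj])
  define \<tau> where "\<tau> = inv_into I h"
  have \<tau>h: "\<tau> (h t) = t" if "t \<in> I" for t using inj that by (simp add: \<tau>_def)
  have \<tau>I: "\<tau> s \<in> I" if "s \<in> h ` I" for s using that \<tau>h by auto
  have cont\<tau>: "continuous_on (h ` I) \<tau>"
    by (rule continuous_on_inverse_open[OF I(1) conthI _ \<tau>h]) simp_all
  define V where "V = h ` I \<times> J"
  have openV: "open V" unfolding V_def by (intro open_Times openhI J)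
  define \<Theta> where "\<Theta> j = (\<lambda>(s, \<zeta>). \<phi> j (\<tau> s) \<zeta>)" for j
  have contG: "continuous_on \<Omega> (G j)" for j
    using has_derivative_continuous[OF G] by (intro continuous_at_imp_continuous_on) blast
  have cont\<phi>: "continuous_on (I \<times> J) (\<lambda>(t, \<zeta>). \<phi> j t \<zeta>)" for j
    unfolding \<phi>_def case_prod_beta
    by (rule continuous_on_compose2[OF contG, unfolded case_prod_beta])
       (use continuous_on_subset[OF cont\<sigma>[unfolded case_prod_beta], of "I \<times> J"] IT \<sigma>\<Omega> in auto)
  have cont\<Theta>: "continuous_on V (\<Theta> j)" for j
    unfolding \<Theta>_def V_def case_prod_beta
    by (rule continuous_on_compose2[OF cont\<phi>[unfolded case_prod_beta], where f = "\<lambda>x. (\<tau> (fst x), snd x)", simplified])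
       (auto intro!: continuous_intros continuous_on_compose2[OF cont\<tau>] \<tau>I)
  have "(\<Theta> j has_derivative (\<lambda>(r, s). r * \<Theta> (Suc (Suc j)) q + s * \<Theta> (Suc j) q)) (at q)"
    if q: "q \<in> V" for j q
  proof -
    obtain s \<zeta> where sz: "q = (s, \<zeta>)" "s \<in> h ` I" "\<zeta> \<in> J" using q by (auto simp: V_def)
    have cp: "continuous_on I (\<lambda>t. \<phi> (Suc (Suc j)) t \<zeta>)"
      by (rule continuous_on_compose2[OF cont\<phi>[of "Suc (Suc j)", unfolded case_prod_beta], where f = "\<lambda>t. (t, \<zeta>)", simplified])
         (auto intro!: continuous_intros sz)
    \<comment> \<open>The factor k^2 in \<open>dt\<close> is the derivative of h and disappears on
      passing from t to s = h(t).\<close>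
    have 1: "((\<lambda>s. \<phi> j (\<tau> s) \<zeta>) has_real_derivative \<phi> (Suc (Suc j)) (\<tau> s) \<zeta>) (at s)"
      by (rule has_real_derivative_reparametrized[OF I openhI h dt[OF _ sz(3)] cp \<tau>h cont\<tau> sz(2)])
         (use IT in auto)
    have 2: "continuous_on (h ` I \<times> J) (\<lambda>(s, \<zeta>). \<phi> (Suc j) (\<tau> s) \<zeta>)"
      using cont\<Theta>[of "Suc j"] by (simp add: \<Theta>_def V_def)
    show ?thesis
      unfolding sz(1) \<Theta>_def prod.case
      by (rule has_derivative_pair_of_partials[where f = "\<lambda>s. \<phi> j (\<tau> s)" and
            fs = "\<lambda>s. \<phi> (Suc (Suc j)) (\<tau> s)" and fz = "\<lambda>s. \<phi> (Suc j) (\<tau> s)",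
            OF openhI J sz(2,3) 1 d\<zeta>[OF \<tau>I] 2])
  qed
  then have heat: "heat_solution V (\<Theta> 0)" by (rule heat_solution_of_sequence[OF openV])
  have "G 0 q = \<Theta> 0 (z q)" if "q \<in> U" for q
    using const[OF that] \<tau>h[of "fst q"] that by (simp add: \<Theta>_def z_def U_def)
  moreover have "z ` U \<subseteq> V" by (auto simp: U_def z_def V_def)
  ultimately show ?thesis
    using openU pU U\<Omega> heat by blast
qed

section \<open>Adapted functions and the common kernel\<close>

abbreviation "De \<equiv> dir_deriv e"

text \<open>The differential of an adapted function is \<open>De (De f) dz\<^sub>1 + De f dz\<^sub>2\<close>, and \<open>De\<close> preserves
  adaptedness, so the iterates \<open>De\<^sup>j f\<close> form a sequence as in \<open>factor_through_z\<close>.\<close>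

definition adapted :: "pt set \<Rightarrow> (pt \<Rightarrow> real) \<Rightarrow> bool" where
  "adapted S f \<longleftrightarrow> smooth_on S f \<and> (\<forall>p\<in>S. Dx f p = k (fst p) * De f p \<and> Dy f p = m * De f p \<and>
     Dt f p = (k (fst p))\<^sup>2 * De (De f) p + (2 * \<gamma> (fst p) * k (fst p) - m) * fst (snd p) * De f p)"

lemma De_eq:
  assumes "smooth_on S f" "p \<in> S"
  shows "De f p = c1 * Dx f p + c2 * Dy f p"
  using dir_deriv_triple[OF assms, of e] by (simp add: e_def)

lemma adapted_has_derivative:
  assumes "adapted S f" "p \<in> S"
  shows "(f has_derivative (\<lambda>v. dz1 p v * De (De f) p + dz2 p v * De f p)) (at p)"
proof -
  have sm: "smooth_on S f" using assms(1) by (simp add: adapted_def)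
  have eqs: "Dx f p = k (fst p) * De f p" "Dy f p = m * De f p"
    "Dt f p = (k (fst p))\<^sup>2 * De (De f) p + (2 * \<gamma> (fst p) * k (fst p) - m) * fst (snd p) * De f p"
    using assms by (simp_all add: adapted_def)
  have "dir_deriv v f p = dz1 p v * De (De f) p + dz2 p v * De f p" for v
    by (rule trans[OF dir_deriv_triple[OF sm assms(2)]])
       (simp only: eqs dz1_def dz2_def, simp add: algebra_simps)
  then show ?thesis
    by (intro has_derivative_eq_rhs[OF smooth_on_has_derivative[OF sm assms(2)]] ext)
qed

lemma De_time_coefficient:
  assumes "smooth_on S f" "p \<in> S" "(c has_real_derivative d) (at (fst p))"
  shows "De (\<lambda>q. c (fst q) * f q) p = c (fst p) * De f p"
  using dir_deriv_eq[OF has_derivative_mult[OF has_derivative_time[OF assms(3)]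
      smooth_on_has_derivative[OF assms(1,2)]], of e] by (simp add: e_def)

text \<open>Along e the time is constant, so \<open>De\<close> commutes with the partial derivatives
  and with coefficients depending on t. Only the factor x in the formula for Dt f resists; its extra
  term is c1 k' De f, which is zero by \<open>c1_deriv_k\<close>.\<close>

lemma adapted_De:
  assumes S: "open S" "S \<subseteq> dom" and f: "adapted S f"
  shows "adapted S (De f)"
  unfolding adapted_def
proof (intro conjI ballI)
  have sm: "smooth_on S f" using f by (simp add: adapted_def)
  show sm1: "smooth_on S (De f)" by (rule smooth_on_dir_deriv[OF sm])
  have sm2: "smooth_on S (De (De f))" by (rule smooth_on_dir_deriv[OF sm1])
  fix p assume p: "p \<in> S"
  have t: "fst p \<in> T" using p S by auto
  have comm: "dir_deriv v (De f) p = De (dir_deriv v f) p" for v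
    by (rule dir_deriv_commute[OF S(1) smooth_onD[OF sm] p])
  have "De (Dx f) p = De (\<lambda>q. k (fst q) * De f q) p"
    by (rule dir_deriv_cong[OF S(1) p]) (use f in \<open>simp add: adapted_def\<close>)
  then show "Dx (De f) p = k (fst p) * De (De f) p"
    unfolding comm[of "(0,1,0)"] De_time_coefficient[OF sm1 p k[OF t]] .
  have "De (Dy f) p = De (\<lambda>q. m * De f q) p"
    by (rule dir_deriv_cong[OF S(1) p]) (use f in \<open>simp add: adapted_def\<close>)
  then show "Dy (De f) p = m * De (De f) p"
    unfolding comm[of "(0,0,1)"] De_time_coefficient[OF sm1 p DERIV_const] .
  define \<kappa> where "\<kappa> t = 2 * \<gamma> t * k t - m" for t
  have d\<kappa>: "(\<kappa> has_real_derivative 2 * (2 * (\<gamma> (fst p))\<^sup>2 * k (fst p) + \<kappa> (fst p) * \<gamma> (fst p))) (at (fst p))"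
    unfolding \<kappa>_def[abs_def]
    by (auto intro!: derivative_eq_intros \<gamma>[OF t] k[OF t] simp: algebra_simps)
  have dk2: "((\<lambda>t. (k t)\<^sup>2) has_real_derivative 2 * k (fst p) * \<kappa> (fst p)) (at (fst p))"
    unfolding \<kappa>_def by (auto intro!: derivative_eq_intros k[OF t] simp: algebra_simps)
  have "De (Dt f) p = De (\<lambda>q. (k (fst q))\<^sup>2 * De (De f) q + \<kappa> (fst q) * (fst (snd q) * De f q)) p"
    by (rule dir_deriv_cong[OF S(1) p]) (use f in \<open>simp add: adapted_def \<kappa>_def\<close>)
  also have "\<dots> = De (\<lambda>q. (k (fst q))\<^sup>2 * De (De f) q) p + De (\<lambda>q. \<kappa> (fst q) * (fst (snd q) * De f q)) p"
  proof -
    have "((\<lambda>q. (k (fst q))\<^sup>2 * De (De f) q) has_derivative (\<lambda>v. (k (fst p))\<^sup>2 * dir_deriv v (De (De f)) p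
        + fst v * (2 * k (fst p) * \<kappa> (fst p)) * De (De f) p)) (at p)"
      by (intro has_derivative_mult[OF has_derivative_time[OF dk2] smooth_on_has_derivative[OF sm2 p]])
    moreover have xD: "((\<lambda>q. fst (snd q) * De f q) has_derivative (\<lambda>v. fst (snd p) * dir_deriv v (De f) p
        + fst (snd v) * De f p)) (at p)"
      by (intro has_derivative_mult smooth_on_has_derivative[OF sm1 p] has_derivative_fst
          has_derivative_snd has_derivative_ident)
    note has_derivative_mult[OF has_derivative_time[OF d\<kappa>] xD]
    ultimately have "((\<lambda>q. (k (fst q))\<^sup>2 * De (De f) q) has_derivative (\<lambda>v. dir_deriv v (\<lambda>q. (k (fst q))\<^sup>2 * De (De f) q) p)) (at p)"
      and "((\<lambda>q. \<kappa> (fst q) * (fst (snd q) * De f q)) has_derivative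
        (\<lambda>v. dir_deriv v (\<lambda>q. \<kappa> (fst q) * (fst (snd q) * De f q)) p)) (at p)"
      by (auto intro!: has_derivative_dir_deriv differentiableI)
    from dir_deriv_eq[OF has_derivative_add[OF this]] show ?thesis .
  qed
  also have "De (\<lambda>q. (k (fst q))\<^sup>2 * De (De f) q) p = (k (fst p))\<^sup>2 * De (De (De f)) p"
    by (rule De_time_coefficient[OF sm2 p dk2])
  also have "De (\<lambda>q. \<kappa> (fst q) * (fst (snd q) * De f q)) p = \<kappa> (fst p) * De (\<lambda>q. fst (snd q) * De f q) p"
    by (rule De_time_coefficient[OF _ p d\<kappa>]) (intro smooth_on_mult smooth_on_fst_snd sm1 S(1))
  also have "De (\<lambda>q. fst (snd q) * De f q) p = fst (snd p) * De (De f) p + c1 * De f p"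
  proof -
    have "((\<lambda>q. fst (snd q) * De f q) has_derivative (\<lambda>v. fst (snd p) * dir_deriv v (De f) p
        + fst (snd v) * De f p)) (at p)"
      by (intro has_derivative_mult smooth_on_has_derivative[OF sm1 p] has_derivative_fst
          has_derivative_snd has_derivative_ident)
    from dir_deriv_eq[OF this, of e] show ?thesis by (simp add: e_def)
  qed
  also have "\<kappa> (fst p) * (fst (snd p) * De (De f) p + c1 * De f p) = \<kappa> (fst p) * fst (snd p) * De (De f) p"
    using c1_deriv_k[OF t, folded \<kappa>_def] by algebra
  finally show "Dt (De f) p = (k (fst p))\<^sup>2 * De (De (De f)) p
      + (2 * \<gamma> (fst p) * k (fst p) - m) * fst (snd p) * De (De f) p"
    unfolding comm[of "(1,0,0)"] \<kappa>_def .
qed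

lemma weighted_derivatives:
  assumes S: "S \<subseteq> dom" and f: "smooth_on S f" and p: "p \<in> S"
  shows "Dt (\<lambda>q. w q * f q) p = w p * ((\<gamma> (fst p) + (fst (snd p))\<^sup>2 * (\<gamma> (fst p))\<^sup>2) * f p + Dt f p)"
    and "Dx (\<lambda>q. w q * f q) p = w p * (fst (snd p) * \<gamma> (fst p) * f p + Dx f p)"
    and "Dy (\<lambda>q. w q * f q) p = w p * Dy f p"
proof -
  have t: "fst p \<in> T" using p S by auto
  note d = dir_deriv_eq[OF has_derivative_mult[OF w[OF t] smooth_on_has_derivative[OF f p]]]
  show "Dt (\<lambda>q. w q * f q) p = w p * ((\<gamma> (fst p) + (fst (snd p))\<^sup>2 * (\<gamma> (fst p))\<^sup>2) * f p + Dt f p)"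
    "Dx (\<lambda>q. w q * f q) p = w p * (fst (snd p) * \<gamma> (fst p) * f p + Dx f p)"
    "Dy (\<lambda>q. w q * f q) p = w p * Dy f p"
    unfolding d by (simp_all add: algebra_simps)
qed

text \<open>For g = v / w, the operator says that the (x, y)-gradient of g is parallel to (k, m),
  and transversality identifies the factor as De g. The equation becomes Dt g = Dx Dx g + 2 x
  \<gamma> Dx g - x Dy g; inserting Dx g = k De g and Dy g = m De g gives the formula for
  Dt.\<close>

lemma adapted_of_kernel:
  assumes S: "open S" "S \<subseteq> dom" and v: "smooth_on S v" "\<And>p. p \<in> S \<Longrightarrow> A v p = 0" "\<And>p. p \<in> S \<Longrightarrow> kolmogorov v p = 0"
  shows "adapted S (\<lambda>p. inverse (w p) * v p)"
proof -
  define g where "g = (\<lambda>p. inverse (w p) * v p)"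
  have g: "smooth_on S g" unfolding g_def
    by (intro smooth_on_mult smooth_on_inverse_weight S v(1))
  have pT: "fst p \<in> T" if "p \<in> S" for p using that S by auto
  have wz: "w p \<noteq> 0" if "p \<in> S" for p by (rule w_nz[OF pT[OF that]])
  have vg: "v p = w p * g p" if "p \<in> S" for p using wz[OF that] by (simp add: g_def)
  have vd: "dir_deriv e' v p = dir_deriv e' (\<lambda>q. w q * g q) p" if "p \<in> S" for e' p
    by (rule dir_deriv_cong[OF S(1) that vg])
  note wd = weighted_derivatives[OF S(2)]
  define g' where "g' = (\<lambda>p. (fst (snd p) * \<gamma> (fst p)) * g p + Dx g p)"
  have g': "smooth_on S g'" unfolding g'_def
    by (intro smooth_on_add smooth_on_mult smooth_on_fst_snd smooth_on_gamma g smooth_on_dir_deriv S)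
  have Dxg': "Dx g' p = \<gamma> (fst p) * g p + fst (snd p) * \<gamma> (fst p) * Dx g p + Dx (Dx g) p" if p: "p \<in> S" for p
  proof -
    have "(g' has_derivative (\<lambda>u. ((fst (snd p) * \<gamma> (fst p)) * dir_deriv u g p
        + (fst (snd p) * (fst u * (2 * (\<gamma> (fst p))\<^sup>2)) + fst (snd u) * \<gamma> (fst p)) * g p) + dir_deriv u (Dx g) p)) (at p)"
      unfolding g'_def
      by (intro has_derivative_add has_derivative_mult has_derivative_time \<gamma> pT[OF p]
          smooth_on_has_derivative[OF _ p] g smooth_on_dir_deriv
          has_derivative_fst has_derivative_snd has_derivative_ident)
    from dir_deriv_eq[OF this, of "(0,1,0)"] show ?thesis by simp
  qed
  have Dxv: "Dx v p = w p * g' p" if "p \<in> S" for p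
    unfolding vd[OF that] wd(2)[OF g that] by (simp add: g'_def)
  have Dxxv: "Dx (Dx v) p = w p * (fst (snd p) * \<gamma> (fst p) * g' p + Dx g' p)" if "p \<in> S" for p
    using dir_deriv_cong[OF S(1) that Dxv] wd(2)[OF g' that] by simp
  have ratio: "m * Dx g p = k (fst p) * Dy g p" if p: "p \<in> S" for p
  proof -
    note t = pT[OF p]
    have "A v p = w p * ((a (fst p) * \<gamma> (fst p) + \<alpha> (fst p)) * fst (snd p) * g p
        + a (fst p) * Dx g p + b (fst p) * Dy g p)"
      unfolding sym_op_def vg[OF p] vd[OF p] wd[OF g p] by (simp add: algebra_simps)
    also have "\<dots> = w p * lam (fst p) * (m * Dx g p - k (fst p) * Dy g p)"
      by (simp add: \<alpha>_eq[OF t] lam(2,3)[OF t] algebra_simps)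
    finally show ?thesis using v(2)[OF p] wz[OF p] lam(1)[OF t] by simp
  qed
  have evol: "Dt g p = Dx (Dx g) p + 2 * fst (snd p) * \<gamma> (fst p) * Dx g p - fst (snd p) * Dy g p" if p: "p \<in> S" for p
  proof -
    have "kolmogorov v p = w p * (Dt g p + fst (snd p) * Dy g p - 2 * fst (snd p) * \<gamma> (fst p) * Dx g p - Dx (Dx g) p)"
      unfolding kolmogorov_def Dxxv[OF p] Dxg'[OF p] vd[OF p] wd[OF g p]
      by (simp add: g'_def power2_eq_square algebra_simps)
    then show ?thesis using v(3)[OF p] wz[OF p] by simp
  qed
  have gx: "Dx g p = k (fst p) * De g p" and gy: "Dy g p = m * De g p" if p: "p \<in> S" for p
  proof -
    note tr = transversal[OF pT[OF p]]
    have "k (fst p) * De g p = (k (fst p) * c1 + m * c2) * Dx g p"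
      unfolding De_eq[OF g p] using ratio[OF p] by (simp add: algebra_simps)
    then show "Dx g p = k (fst p) * De g p" using tr by simp
    have "m * De g p = (k (fst p) * c1 + m * c2) * Dy g p"
      unfolding De_eq[OF g p] using ratio[OF p] by (simp add: algebra_simps)
    then show "Dy g p = m * De g p" using tr by simp
  qed
  have gxx: "Dx (Dx g) p = (k (fst p))\<^sup>2 * De (De g) p" if p: "p \<in> S" for p
  proof -
    have sm1: "smooth_on S (De g)" by (rule smooth_on_dir_deriv[OF g])
    have "Dx (Dx g) p = Dx (\<lambda>q. k (fst q) * De g q) p"
      by (rule dir_deriv_cong[OF S(1) p gx])
    also have "\<dots> = k (fst p) * Dx (De g) p"
      using dir_deriv_eq[OF has_derivative_mult[OF has_derivative_time[OF k[OF pT[OF p]]]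
          smooth_on_has_derivative[OF sm1 p]], of "(0,1,0)"] by simp
    also have "Dx (De g) p = De (Dx g) p"
      by (rule dir_deriv_commute[OF S(1) smooth_onD[OF g] p])
    also have "De (Dx g) p = De (\<lambda>q. k (fst q) * De g q) p"
      by (rule dir_deriv_cong[OF S(1) p gx])
    also have "\<dots> = k (fst p) * De (De g) p"
      by (rule De_time_coefficient[OF sm1 p k[OF pT[OF p]]])
    finally show ?thesis by (simp add: power2_eq_square)
  qed
  show ?thesis
    unfolding adapted_def g_def[symmetric]
    using g gx gy evol gxx by (simp add: algebra_simps)
qed

lemma kernel_factors:
  assumes S: "open S" "S \<subseteq> dom" and v: "smooth_on S v" "\<And>p. p \<in> S \<Longrightarrow> A v p = 0 \<and> kolmogorov v p = 0"
    and p: "p \<in> S"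
  shows "\<exists>U V \<theta>. open U \<and> p \<in> U \<and> U \<subseteq> S \<and> z ` U \<subseteq> V \<and> heat_solution V \<theta> \<and> (\<forall>q\<in>U. v q = w q * \<theta> (z q))"
proof -
  define g where "g = (\<lambda>p. inverse (w p) * v p)"
  have ad: "adapted S ((De ^^ j) g)" for j
  proof (induction j)
    case 0
    show ?case unfolding funpow_0 g_def by (rule adapted_of_kernel[OF S v(1)]) (use v(2) in blast)+
  next
    case (Suc j)
    then show ?case using adapted_De[OF S] by simp
  qed
  have "((De ^^ j) g has_derivative (\<lambda>v. dz1 q v * (De ^^ Suc (Suc j)) g q + dz2 q v * (De ^^ Suc j) g q)) (at q)"
    if "q \<in> S" for j q
    using adapted_has_derivative[OF ad that] by simp
  from factor_through_z[where G = "\<lambda>j. (De ^^ j) g", OF S p this] obtain U V \<theta> where *: "open U" "p \<in> U" "U \<subseteq> S" "z ` U \<subseteq> V"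
    "heat_solution V \<theta>" and g: "\<And>q. q \<in> U \<Longrightarrow> (De ^^ 0) g q = \<theta> (z q)"
    by blast
  have "v q = w q * \<theta> (z q)" if "q \<in> U" for q
  proof -
    have "fst q \<in> T" using that *(3) S(2) by auto
    then show ?thesis using g[OF that, symmetric] w_nz by (simp add: g_def)
  qed
  with * show ?thesis by blast
qed

theorem invariant_iff_represented:
  assumes "symmetry a' b' \<alpha>' \<beta>'" "c \<noteq> 0" "\<And>t. a t * \<alpha>' t + b t * \<beta>' - a' t * \<alpha> t = c"
    and "open \<Omega>" "\<Omega> \<subseteq> dom"
  shows "invariant_solution \<Omega> (A ^^ n) u \<longleftrightarrow> locally_represented \<Omega> n (sym_op a' b' \<alpha>' \<beta>') w z u"
proof -
  interpret ladder A "sym_op a' b' \<alpha>' \<beta>'" kolmogorov c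
    by (rule ladder_sym_op[OF symmetry_axioms assms(1,2)]) (simp add: assms(3))
  show ?thesis
    by (rule invariant_iff_represented[OF refl assms(4,5) heat_solution_lifts kernel_factors[OF assms(4,5)]])
qed

end

subsection \<open>The three families\<close>

lemma P0_eq: "P0 = sym_op (\<lambda>_. 0) (\<lambda>_. 1) (\<lambda>_. 0) 0"
  by (auto simp: P0_def sym_op_def fun_eq_iff)

lemma P1_eq: "P1 = sym_op (\<lambda>_. 1) (\<lambda>t. t) (\<lambda>_. 0) 0"
  by (auto simp: P1_def sym_op_def fun_eq_iff)

lemma P2_eq: "P2 = sym_op (\<lambda>t. 2 * t) (\<lambda>t. t\<^sup>2) (\<lambda>_. 1) 0"
  by (auto simp: P2_def sym_op_def fun_eq_iff)

lemma P3_eq: "P3 = sym_op (\<lambda>t. 3 * t\<^sup>2) (\<lambda>t. t ^ 3) (\<lambda>t. 3 * t) (- 3)"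
  by (auto simp: P3_def sym_op_def fun_eq_iff algebra_simps)

lemma P2_P0_eq: "(\<lambda>v p. P2 v p + \<epsilon> * P0 v p) = sym_op (\<lambda>t. 2 * t) (\<lambda>t. t\<^sup>2 + \<epsilon>) (\<lambda>_. 1) 0"
  by (auto simp: P2_def P0_def sym_op_def fun_eq_iff algebra_simps)

lemma symmetry_P0: "symmetry (\<lambda>_. 0) (\<lambda>_. 1) (\<lambda>_. 0) 0"
  by unfold_locales (auto intro!: derivative_eq_intros)

lemma symmetry_P1: "symmetry (\<lambda>_. 1) (\<lambda>t. t) (\<lambda>_. 0) 0"
  by unfold_locales (auto intro!: derivative_eq_intros)

text \<open>Valid for every \<epsilon>; the value 0 gives \<open>P2\<close> itself, the raising
  operator of the second family.\<close>

lemma symmetry_P2: "symmetry (\<lambda>t. 2 * t) (\<lambda>t. t\<^sup>2 + \<epsilon>) (\<lambda>_. 1) 0"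
  by unfold_locales (auto intro!: derivative_eq_intros)

lemma symmetry_P3: "symmetry (\<lambda>t. 3 * t\<^sup>2) (\<lambda>t. t ^ 3) (\<lambda>t. 3 * t) (- 3)"
  by unfold_locales (auto intro!: derivative_eq_intros simp: power2_eq_square)

lemma has_real_derivative_abs_powr:
  fixes t :: real
  assumes "t \<noteq> 0"
  shows "((\<lambda>t. \<bar>t\<bar> powr r) has_real_derivative \<bar>t\<bar> powr r * (r / t)) (at t)"
proof (cases "t > 0")
  case True
  have "((\<lambda>t. t powr r) has_real_derivative t powr r * (r / t)) (at t)"
    using True by (auto intro!: derivative_eq_intros simp: powr_diff field_simps)
  then have "((\<lambda>t. \<bar>t\<bar> powr r) has_real_derivative t powr r * (r / t)) (at t)"
    by (rule has_field_derivative_transform_within_open[OF _ open_greaterThan[of 0]]) (use True in auto)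
  then show ?thesis using True by simp
next
  case False
  then have t: "t < 0" using assms by simp
  have "((\<lambda>t. (- t) powr r) has_real_derivative (- t) powr r * (r / t)) (at t)"
    using t by (auto intro!: derivative_eq_intros simp: powr_diff field_simps)
  then have "((\<lambda>t. \<bar>t\<bar> powr r) has_real_derivative (- t) powr r * (r / t)) (at t)"
    by (rule has_field_derivative_transform_within_open[OF _ open_lessThan[of 0]]) (use t in auto)
  then show ?thesis using t by simp
qed

lemma has_derivative_heat_kernel:
  fixes p :: pt
  assumes "fst p \<noteq> 0"
  shows "((\<lambda>(t, x, y). \<bar>t\<bar> powr (- 1 / 2) * exp (- (x\<^sup>2 / (4 * t)))) has_derivative
    (\<lambda>v. (case p of (t, x, y) \<Rightarrow> \<bar>t\<bar> powr (- 1 / 2) * exp (- (x\<^sup>2 / (4 * t)))) *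
      (fst v * (- 1 / (2 * fst p) + (fst (snd p))\<^sup>2 * (- 1 / (2 * fst p))\<^sup>2)
        + fst (snd v) * (fst (snd p) * (- 1 / (2 * fst p)))))) (at p)"
proof -
  let ?t = "fst p" and ?x = "fst (snd p)"
  have x: "((\<lambda>p::pt. fst (snd p)) has_derivative (\<lambda>v. fst (snd v))) (at p)"
    by (intro has_derivative_fst has_derivative_snd has_derivative_ident)
  have "((\<lambda>t. - 1 / (4 * t)) has_real_derivative 1 / (4 * ?t\<^sup>2)) (at ?t)"
    using assms by (auto intro!: derivative_eq_intros simp: field_simps power2_eq_square)
  note q = has_derivative_mult[OF has_derivative_mult[OF x x] has_derivative_time[OF this]]
  note E = has_derivative_exp[OF q]
  have "((\<lambda>p::pt. \<bar>fst p\<bar> powr (- 1 / 2) * exp (fst (snd p) * fst (snd p) * (- 1 / (4 * fst p)))) has_derivative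
    (\<lambda>v. (\<bar>?t\<bar> powr (- 1 / 2) * exp (?x * ?x * (- 1 / (4 * ?t)))) *
      (fst v * (- 1 / (2 * ?t) + ?x\<^sup>2 * (- 1 / (2 * ?t))\<^sup>2) + fst (snd v) * (?x * (- 1 / (2 * ?t)))))) (at p)"
    by (rule has_derivative_eq_rhs[OF has_derivative_mult[OF has_derivative_time[OF has_real_derivative_abs_powr[OF assms]] E]])
       (use assms in \<open>simp add: fun_eq_iff field_simps power2_eq_square\<close>)
  moreover have "(\<lambda>p::pt. \<bar>fst p\<bar> powr (- 1 / 2) * exp (fst (snd p) * fst (snd p) * (- 1 / (4 * fst p))))
    = (\<lambda>(t, x, y). \<bar>t\<bar> powr (- 1 / 2) * exp (- (x\<^sup>2 / (4 * t))))"
    by (auto simp: fun_eq_iff power2_eq_square)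
  ultimately show ?thesis by (simp add: case_prod_beta power2_eq_square)
qed

text \<open>The data are forced by the operator up to scaling: \<alpha> = - a \<gamma> gives
  \<gamma> = - 1/(2 t), whose weight is the heat kernel in (t, x); the normalization m = 2 gives lam
  = t from a = lam m, and then k from b = - lam k. The transversal vector is the multiple of the
  y-direction with m c2 = 1.\<close>

lemma heat_reduction_P2_P0:
  assumes "\<epsilon>\<^sup>2 = 1"
  shows "heat_reduction (\<lambda>t. 2 * t) (\<lambda>t. t\<^sup>2 + \<epsilon>) (\<lambda>_. 1) (\<lambda>t. - 1 / (2 * t)) (\<lambda>t. - (t + \<epsilon> / t))
    (\<lambda>t. t ^ 3 / 3 + 2 * \<epsilon> * t - 1 / t) (\<lambda>t. t) 2 0 (1 / 2) {t. t \<noteq> 0}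
    (\<lambda>(t, x, y). \<bar>t\<bar> powr (- 1 / 2) * exp (- (x\<^sup>2 / (4 * t))))"
proof -
  interpret symmetry "\<lambda>t. 2 * t" "\<lambda>t. t\<^sup>2 + \<epsilon>" "\<lambda>_. 1" 0 by (rule symmetry_P2)
  show ?thesis
  proof unfold_locales
    show "open {t :: real. t \<noteq> 0}" using open_delete[OF open_UNIV, of "0::real"] by (simp add: set_diff_eq)
    fix t :: real assume "t \<in> {t. t \<noteq> 0}"
    then have t: "t \<noteq> 0" by simp
    show "((\<lambda>t. - 1 / (2 * t)) has_real_derivative 2 * (- 1 / (2 * t))\<^sup>2) (at t)"
      using t by (auto intro!: derivative_eq_intros simp: field_simps power2_eq_square)
    show "((\<lambda>t. - (t + \<epsilon> / t)) has_real_derivative 2 * (- 1 / (2 * t)) * - (t + \<epsilon> / t) - 2) (at t)"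
      using t by (auto intro!: derivative_eq_intros simp: field_simps power2_eq_square)
    \<comment> \<open>This is where \<epsilon>^2 = 1 enters: it turns the last term into the
      derivative of - 1/t.\<close>
    have "(t + \<epsilon> / t)\<^sup>2 = t\<^sup>2 + 2 * \<epsilon> + \<epsilon>\<^sup>2 / t\<^sup>2"
      using t by (simp add: field_simps power2_eq_square)
    also have "\<dots> = t\<^sup>2 + 2 * \<epsilon> + 1 / t\<^sup>2" by (simp add: assms)
    finally show "((\<lambda>t. t ^ 3 / 3 + 2 * \<epsilon> * t - 1 / t) has_real_derivative (- (t + \<epsilon> / t))\<^sup>2) (at t)"
      using t by (auto intro!: derivative_eq_intros simp: field_simps power2_eq_square)
    show "1 = - (2 * t) * (- 1 / (2 * t))" "t \<noteq> 0" "2 * t = t * 2" "t\<^sup>2 + \<epsilon> = - t * - (t + \<epsilon> / t)"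
      "- (t + \<epsilon> / t) * 0 + 2 * (1 / 2) = 1"
      using t by (simp_all add: field_simps power2_eq_square)
  next
    fix p :: pt assume "fst p \<in> {t. t \<noteq> 0}"
    then have p: "fst p \<noteq> 0" by simp
    show "(case p of (t, x, y) \<Rightarrow> \<bar>t\<bar> powr (- 1 / 2) * exp (- (x\<^sup>2 / (4 * t)))) \<noteq> 0"
      using p by (auto simp: case_prod_beta)
    show "((\<lambda>(t, x, y). \<bar>t\<bar> powr (- 1 / 2) * exp (- (x\<^sup>2 / (4 * t)))) has_derivative
    (\<lambda>v. (case p of (t, x, y) \<Rightarrow> \<bar>t\<bar> powr (- 1 / 2) * exp (- (x\<^sup>2 / (4 * t)))) *
      (fst v * (- 1 / (2 * fst p) + (fst (snd p))\<^sup>2 * (- 1 / (2 * fst p))\<^sup>2)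
        + fst (snd v) * (fst (snd p) * (- 1 / (2 * fst p)))))) (at p)"
      by (rule has_derivative_heat_kernel[OF p])
  qed
qed

text \<open>The case where k = - t vanishes at t = 0 and the domain includes that time, so z1 =
  t^3/3 is not a diffeomorphism.\<close>

lemma heat_reduction_P1:
  "heat_reduction (\<lambda>_. 1) (\<lambda>t. t) (\<lambda>_. 0) (\<lambda>_. 0) (\<lambda>t. - t) (\<lambda>t. t ^ 3 / 3) (\<lambda>_. 1) 1 0 1 UNIV (\<lambda>_. 1)"
proof -
  interpret symmetry "\<lambda>_. 1" "\<lambda>t. t" "\<lambda>_. 0" 0 by (rule symmetry_P1)
  show ?thesis by unfold_locales (auto intro!: derivative_eq_intros)
qed

text \<open>Here m = 0: the operator differentiates along y only, z2 is x itself, and the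
  transversal vector is the x-direction. With k = 1, the relation b = - lam k forces lam = -
  1.\<close>

lemma heat_reduction_P0:
  "heat_reduction (\<lambda>_. 0) (\<lambda>_. 1) (\<lambda>_. 0) (\<lambda>_. 0) (\<lambda>_. 1) (\<lambda>t. t) (\<lambda>_. - 1) 0 1 0 UNIV (\<lambda>_. 1)"
proof -
  interpret symmetry "\<lambda>_. 0" "\<lambda>_. 1" "\<lambda>_. 0" 0 by (rule symmetry_P0)
  show ?thesis by unfold_locales (auto intro!: derivative_eq_intros)
qed

theorem mainTheorem8:
  fixes n :: nat and \<epsilon> :: real and \<Omega> :: "(real \<times> real \<times> real) set"
    and u :: "real \<times> real \<times> real \<Rightarrow> real"
  assumes "n > 0" and "\<epsilon> \<in> {-1, 1}" and "open \<Omega>"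
  shows "((\<forall>(t, x, y)\<in>\<Omega>. t \<noteq> 0) \<longrightarrow>
           (invariant_solution \<Omega> ((\<lambda>v p. P2 v p + \<epsilon> * P0 v p) ^^ n) u \<longleftrightarrow>
            locally_represented \<Omega> n P1
              (\<lambda>(t, x, y). \<bar>t\<bar> powr (- 1 / 2) * exp (- (x^2 / (4 * t))))
              (\<lambda>(t, x, y). (t^3 / 3 + 2 * \<epsilon> * t - 1 / t, 2 * y - (t + \<epsilon> / t) * x)) u)) \<and>
         (invariant_solution \<Omega> (P1 ^^ n) u \<longleftrightarrow>
            locally_represented \<Omega> n P2
              (\<lambda>_. 1) (\<lambda>(t, x, y). (t^3 / 3, y - t * x)) u) \<and>
         (invariant_solution \<Omega> (P0 ^^ n) u \<longleftrightarrow>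
            locally_represented \<Omega> n P3
              (\<lambda>_. 1) (\<lambda>(t, x, y). (t, x)) u)"
proof (intro conjI impI)
  assume t0: "\<forall>(t, x, y)\<in>\<Omega>. t \<noteq> 0"
  have "\<epsilon>\<^sup>2 = 1" using assms(2) by auto
  interpret r: heat_reduction "\<lambda>t. 2 * t" "\<lambda>t. t\<^sup>2 + \<epsilon>" "\<lambda>_. 1" "\<lambda>t. - 1 / (2 * t)" "\<lambda>t. - (t + \<epsilon> / t)"
    "\<lambda>t. t ^ 3 / 3 + 2 * \<epsilon> * t - 1 / t" "\<lambda>t. t" 2 0 "1 / 2" "{t. t \<noteq> 0}"
    "\<lambda>(t, x, y). \<bar>t\<bar> powr (- 1 / 2) * exp (- (x\<^sup>2 / (4 * t)))"
    by (rule heat_reduction_P2_P0[OF \<open>\<epsilon>\<^sup>2 = 1\<close>])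
  have z: "r.z = (\<lambda>(t, x, y). (t ^ 3 / 3 + 2 * \<epsilon> * t - 1 / t, 2 * y - (t + \<epsilon> / t) * x))"
    unfolding fun_eq_iff r.z_def r.z2_def by (auto simp: algebra_simps)
  show "invariant_solution \<Omega> ((\<lambda>v p. P2 v p + \<epsilon> * P0 v p) ^^ n) u \<longleftrightarrow>
      locally_represented \<Omega> n P1 (\<lambda>(t, x, y). \<bar>t\<bar> powr (- 1 / 2) * exp (- (x\<^sup>2 / (4 * t))))
        (\<lambda>(t, x, y). (t ^ 3 / 3 + 2 * \<epsilon> * t - 1 / t, 2 * y - (t + \<epsilon> / t) * x)) u"
    unfolding P2_P0_eq P1_eq z[symmetric]
    \<comment> \<open>The commutator of \<open>P2\<close> + \<epsilon> \<open>P0\<close> with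
      \<open>P1\<close> is -1, for any \<epsilon>.\<close>
    by (rule r.invariant_iff_represented[OF symmetry_P1, of "- 1"]) (use assms(3) t0 in auto)
next
  interpret r: heat_reduction "\<lambda>_. 1" "\<lambda>t. t" "\<lambda>_. 0" "\<lambda>_. 0" "\<lambda>t. - t" "\<lambda>t. t ^ 3 / 3" "\<lambda>_. 1" 1 0 1 UNIV "\<lambda>_. 1"
    by (rule heat_reduction_P1)
  have z: "r.z = (\<lambda>(t, x, y). (t ^ 3 / 3, y - t * x))"
    unfolding fun_eq_iff r.z_def r.z2_def by auto
  show "invariant_solution \<Omega> (P1 ^^ n) u \<longleftrightarrow>
      locally_represented \<Omega> n P2 (\<lambda>_. 1) (\<lambda>(t, x, y). (t ^ 3 / 3, y - t * x)) u"
    unfolding P1_eq P2_eq z[symmetric]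
    \<comment> \<open>The commutator of \<open>P1\<close> with \<open>P2\<close> is 1.\<close>
    by (rule r.invariant_iff_represented[OF symmetry_P2[of 0, simplified], of 1]) (use assms(3) in auto)
next
  interpret r: heat_reduction "\<lambda>_. 0" "\<lambda>_. 1" "\<lambda>_. 0" "\<lambda>_. 0" "\<lambda>_. 1" "\<lambda>t. t" "\<lambda>_. - 1" 0 1 0 UNIV "\<lambda>_. 1"
    by (rule heat_reduction_P0)
  have z: "r.z = (\<lambda>(t, x, y). (t, x))"
    unfolding fun_eq_iff r.z_def r.z2_def by auto
  show "invariant_solution \<Omega> (P0 ^^ n) u \<longleftrightarrow> locally_represented \<Omega> n P3 (\<lambda>_. 1) (\<lambda>(t, x, y). (t, x)) u"
    unfolding P0_eq P3_eq z[symmetric]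
    \<comment> \<open>\<open>P0\<close> differentiates the term - 3 y of \<open>P3\<close>, whence
      the constant -3.\<close>
    by (rule r.invariant_iff_represented[OF symmetry_P3, of "- 3"]) (use assms(3) in auto)
qed

end
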